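(* Let $\mathcal{D}$ be a domain and let $G<\mathrm{IET}(\mathcal{D})$ be a finitely generated subgroup. Then $G$ has a finite index subgroup that is stable.
   Context: A domain is a non-empty disjoint union of finitely many oriented circles and oriented half-open bounded intervals closed on the left. A subdomain of $\mathcal{D}$ is a subset of $\mathcal{D}$ which is itself a domain (a finite disjoint union of such circles and half-open intervals). $\mathrm{IET}(\mathcal{D})$ is the group of bijections of $\mathcal{D}$ that are orientation-preserving piecewise isometries, left-continuous, with finitely many discontinuity points. A finitely generated subgroup $G<\mathrm{IET}(\mathcal{D})$ is called stable if every subdomain $J\subset\mathcal{D}$ which is invariant under some finite index subgroup of $G$ is $G$-invariant. *)

theory Defs
  imports Main "HOL-Algebra.Algebra"
begin

text \<open>A domain is encoded as a nonempty list of components; component i is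
  (True, L) for an oriented circle of length L (points 0 \<le> x < L, read modulo L)
  or (False, L) for the half-open interval [0, L). Points are pairs (i, x).\<close>

type_synonym dom_desc = "(bool \<times> real) list"
type_synonym dpt = "nat \<times> real"

definition is_domain :: "dom_desc \<Rightarrow> bool" where
  "is_domain C \<longleftrightarrow> C \<noteq> [] \<and> (\<forall>c \<in> set C. snd c > 0)"

definition dpts :: "dom_desc \<Rightarrow> dpt set" where
  "dpts C = {(i, x). i < length C \<and> 0 \<le> x \<and> x < snd (C ! i)}"

definition shift :: "dom_desc \<Rightarrow> dpt \<Rightarrow> real \<Rightarrow> dpt" where
  "shift C p t = (fst p,
     (if fst (C ! fst p)
      then snd (C ! fst p) * frac ((snd p + t) / snd (C ! fst p))
      else snd p + t))"

definition loc_transl :: "dom_desc \<Rightarrow> (dpt \<Rightarrow> dpt) \<Rightarrow> dpt \<Rightarrow> bool" where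
  "loc_transl C f p \<longleftrightarrow> (\<exists>\<delta>>0. \<forall>t. \<bar>t\<bar> < \<delta> \<and> shift C p t \<in> dpts C \<longrightarrow>
       f (shift C p t) = shift C (f p) t)"

definition left_cont :: "dom_desc \<Rightarrow> (dpt \<Rightarrow> dpt) \<Rightarrow> dpt \<Rightarrow> bool" where
  "left_cont C f p \<longleftrightarrow> (\<forall>\<epsilon>>0. \<exists>\<delta>>0. \<forall>t. -\<delta> < t \<and> t \<le> 0 \<and> shift C p t \<in> dpts C \<longrightarrow>
       (\<exists>s. \<bar>s\<bar> < \<epsilon> \<and> f (shift C p t) = shift C (f p) s))"

definition cont_at :: "dom_desc \<Rightarrow> (dpt \<Rightarrow> dpt) \<Rightarrow> dpt \<Rightarrow> bool" where
  "cont_at C f p \<longleftrightarrow> (\<forall>\<epsilon>>0. \<exists>\<delta>>0. \<forall>t. \<bar>t\<bar> < \<delta> \<and> shift C p t \<in> dpts C \<longrightarrow>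
       (\<exists>s. \<bar>s\<bar> < \<epsilon> \<and> f (shift C p t) = shift C (f p) s))"

definition iet :: "dom_desc \<Rightarrow> (dpt \<Rightarrow> dpt) \<Rightarrow> bool" where
  "iet C f \<longleftrightarrow> bij_betw f (dpts C) (dpts C) \<and> (\<forall>p. p \<notin> dpts C \<longrightarrow> f p = p)
     \<and> (\<exists>S. finite S \<and> (\<forall>p \<in> dpts C - S. loc_transl C f p))
     \<and> (\<forall>p \<in> dpts C. left_cont C f p)
     \<and> finite {p \<in> dpts C. \<not> cont_at C f p}"

definition iet_group :: "dom_desc \<Rightarrow> (dpt \<Rightarrow> dpt) monoid" where
  "iet_group C = \<lparr>carrier = {f. iet C f}, monoid.mult = (\<lambda>f g. f \<circ> g), one = id\<rparr>"

definition fg_subgroup :: "dom_desc \<Rightarrow> (dpt \<Rightarrow> dpt) set \<Rightarrow> bool" where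
  "fg_subgroup C G \<longleftrightarrow> subgroup G (iet_group C) \<and>
     (\<exists>A. finite A \<and> A \<subseteq> carrier (iet_group C) \<and> G = generate (iet_group C) A)"

definition finite_index_in :: "dom_desc \<Rightarrow> (dpt \<Rightarrow> dpt) set \<Rightarrow> (dpt \<Rightarrow> dpt) set \<Rightarrow> bool" where
  "finite_index_in C H G \<longleftrightarrow> subgroup H (iet_group C) \<and> H \<subseteq> G \<and>
     finite (rcosets\<^bsub>(iet_group C)\<lparr>carrier := G\<rparr>\<^esub> H)"

text \<open>Half-open arc [a, a+l) in component i (for a circle, 0 < l \<le> L, possibly wrapping;
  l = L gives the whole circle).\<close>
definition arc :: "dom_desc \<Rightarrow> nat \<Rightarrow> real \<Rightarrow> real \<Rightarrow> dpt set" where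
  "arc C i a l = {shift C (i, a) t | t. 0 \<le> t \<and> t < l}"

definition valid_arc :: "dom_desc \<Rightarrow> nat \<Rightarrow> real \<Rightarrow> real \<Rightarrow> bool" where
  "valid_arc C i a l \<longleftrightarrow> i < length C \<and> 0 \<le> a \<and> a < snd (C ! i) \<and> 0 < l \<and>
     (if fst (C ! i) then l \<le> snd (C ! i) else a + l \<le> snd (C ! i))"

definition subdomain :: "dom_desc \<Rightarrow> dpt set \<Rightarrow> bool" where
  "subdomain C J \<longleftrightarrow> J \<noteq> {} \<and> (\<exists>A. finite A \<and> (\<forall>(i, a, l) \<in> A. valid_arc C i a l) \<and>
       J = (\<Union>(i, a, l) \<in> A. arc C i a l))"

definition invariant_under :: "(dpt \<Rightarrow> dpt) set \<Rightarrow> dpt set \<Rightarrow> bool" where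
  "invariant_under H J \<longleftrightarrow> (\<forall>h \<in> H. h ` J = J)"

definition stable :: "dom_desc \<Rightarrow> (dpt \<Rightarrow> dpt) set \<Rightarrow> bool" where
  "stable C G \<longleftrightarrow> fg_subgroup C G \<and>
     (\<forall>J. subdomain C J \<longrightarrow> (\<exists>H. finite_index_in C H G \<and> invariant_under H J)
        \<longrightarrow> invariant_under G J)"

end

theory Submission
  imports Defs
begin

text \<open>A subdomain \<open>J\<close> invariant under a finite index subgroup has a finite \<open>G\<close>-orbit, so the boundary
  points of its translates form a finite set, which a generator maps into itself except at the
  finitely many points where it is not a local translation. Hence a boundary point of \<open>J\<close> lies
  either in a finite set \<open>P\<close> that depends only on the generators, or in the set \<open>U\<close> of points
  whose \<open>G\<close>-orbit is finite and avoids all singularities.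
  Sliding such an orbit to the right until it first hits a singularity or an end point shows that
  \<open>U\<close> consists of finitely many intervals on each of which point stabilizers are constant.
  So a finite index subgroup fixes \<open>U\<close> pointwise, while the sets \<open>J - U\<close>, having
  boundary in a fixed finite set, are finite in number, and a finite index subgroup preserves all
  of them. Finite generation of the subgroup is Schreier's lemma.\<close>

section \<open>Subgroups of finite index\<close>

text \<open>For one \<open>J\<close> invariant under a finite index subgroup, the stabilizer of
  \<open>J\<close> already has finite index, but it varies with \<open>J\<close>. There may be
  infinitely many such \<open>J\<close>, since inside the periodic region a boundary point can be
  placed anywhere, and an intersection of infinitely many stabilizers need not have finite index. So
  the subgroup must be determined by the generators before any \<open>J\<close> is given. This is
  why periodic points are fixed one by one, while elsewhere only the finitely many possible traces
  of \<open>J\<close> are stabilized. Invariance of \<open>J\<close> enters solely through the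
  finiteness of its orbit under all of \<open>G\<close>. This condition passes up a chain of finite
  index subgroups, and it is expressed by translates of \<open>J\<close> alone.\<close>

context group
begin

text \<open>One representative is chosen per right coset, and \<open>\<one>\<close> is adjoined.
  Thus \<open>T\<close> may meet the coset \<open>H\<close> twice, which is harmless; the Schreier
  argument needs \<open>\<one>\<close> both as a starting point and as a trivial factor.\<close>

lemma finite_index_transversal:
  assumes K: "subgroup K G" and H: "subgroup H G" "H \<subseteq> K"
    and fin: "finite (rcosets\<^bsub>G\<lparr>carrier := K\<rparr>\<^esub> H)"
  obtains T where "finite T" "T \<subseteq> K" "\<one> \<in> T" "\<And>g. g \<in> K \<Longrightarrow> \<exists>t\<in>T. g \<otimes> inv t \<in> H"
proof -
  have KG: "K \<subseteq> carrier G" by (rule subgroup.subset[OF K])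
  have eq: "rcosets\<^bsub>G\<lparr>carrier := K\<rparr>\<^esub> H = (\<lambda>a. H #> a) ` K"
    by (auto simp: RCOSETS_def r_coset_def)
  define rep where "rep c = (SOME a. a \<in> K \<and> H #> a = c)" for c
  have rep: "rep (H #> a) \<in> K \<and> H #> rep (H #> a) = H #> a" if "a \<in> K" for a
    unfolding rep_def by (rule someI[of _ a]) (use that in auto)
  show thesis
  proof (rule that[of "insert \<one> (rep ` (\<lambda>a. H #> a) ` K)"])
    fix g assume g: "g \<in> K"
    define t where "t = rep (H #> g)"
    have t: "t \<in> K" "H #> t = H #> g" using rep[OF g] by (auto simp: t_def)
    have "g \<in> H #> t" using rcos_self[OF _ H(1), of g] g KG t(2) by auto
    then obtain h where "h \<in> H" "g = h \<otimes> t" by (auto simp: r_coset_def)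
    then have "g \<otimes> inv t \<in> H"
      using t(1) KG subgroup.subset[OF H(1)] by (auto simp: m_assoc subset_iff)
    then show "\<exists>t\<in>insert \<one> (rep ` (\<lambda>a. H #> a) ` K). g \<otimes> inv t \<in> H"
      using g by (auto simp: t_def)
  qed (use fin rep subgroup.one_closed[OF K] in \<open>auto simp: eq\<close>)
qed

text \<open>Each fibre of \<open>\<phi>\<close> lies in a single right coset, so there are at most
  as many cosets as values of \<open>\<phi>\<close>. The map need not be a homomorphism; below it
  records how an element acts on finite orbits.\<close>

lemma finite_rcosetsI:
  assumes K: "subgroup K G" and H: "subgroup H G"
    and fin: "finite (\<phi> ` K)"
    and \<phi>: "\<And>a b. a \<in> K \<Longrightarrow> b \<in> K \<Longrightarrow> \<phi> a = \<phi> b \<Longrightarrow> b \<otimes> inv a \<in> H"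
  shows "finite (rcosets\<^bsub>G\<lparr>carrier := K\<rparr>\<^esub> H)"
proof -
  have KG: "K \<subseteq> carrier G" by (rule subgroup.subset[OF K])
  have "H #> a = H #> b" if "a \<in> K" "b \<in> K" "\<phi> a = \<phi> b" for a b
  proof (rule repr_independence[OF _ _ H])
    have "b = (b \<otimes> inv a) \<otimes> a" using that KG by (auto simp: m_assoc subset_iff)
    then show "b \<in> H #> a" using \<phi>[OF that] by (auto simp: r_coset_def)
  qed (use that KG in auto)
  then have "H #> a = H #> (SOME b. b \<in> K \<and> \<phi> b = \<phi> a)" if "a \<in> K" for a
    using someI[of "\<lambda>b. b \<in> K \<and> \<phi> b = \<phi> a" a] that by metis
  then have "(\<lambda>a. H #> a) ` K \<subseteq> (\<lambda>v. H #> (SOME b. b \<in> K \<and> \<phi> b = v)) ` \<phi> ` K" by blast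
  moreover have "rcosets\<^bsub>G\<lparr>carrier := K\<rparr>\<^esub> H = (\<lambda>a. H #> a) ` K"
    by (auto simp: RCOSETS_def r_coset_def)
  ultimately show ?thesis using finite_subset[OF _ finite_imageI[OF fin]] by simp
qed

text \<open>Schreier's lemma: the elements \<open>t s t'\<^sup>-\<^sup>1\<close> of the subgroup, with \<open>t, t'\<close> in a finite transversal
  and \<open>s\<close> a generator or its inverse, generate the subgroup.\<close>

lemma finite_index_subgroup_finitely_generated:
  assumes A: "finite A" "A \<subseteq> carrier G" and H: "subgroup H G" "H \<subseteq> generate G A"
    and fin: "finite (rcosets\<^bsub>G\<lparr>carrier := generate G A\<rparr>\<^esub> H)"
  shows "\<exists>B. finite B \<and> B \<subseteq> H \<and> H = generate G B"
proof -
  let ?K = "generate G A"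
  have K: "subgroup ?K G" by (rule generate_is_subgroup[OF A(2)])
  have KG: "?K \<subseteq> carrier G" by (rule subgroup.subset[OF K])
  obtain T where T: "finite T" "T \<subseteq> ?K" "\<one> \<in> T" "\<And>g. g \<in> ?K \<Longrightarrow> \<exists>t\<in>T. g \<otimes> inv t \<in> H"
    using finite_index_transversal[OF K H fin] by blast
  \<comment> \<open>\<open>\<one>\<close> is counted as a letter so that an element of
    \<open>T\<close> lying in \<open>H\<close> belongs to \<open>B\<close> itself.\<close>
  define S where "S = insert \<one> (A \<union> m_inv G ` A)"
  have SK: "S \<subseteq> ?K" by (auto simp: S_def intro: generate.intros)
  \<comment> \<open>Keeping every triple that lands in \<open>H\<close> avoids choosing
    \<open>t'\<close> as a function of \<open>t\<close> and \<open>s\<close>.\<close>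
  define B where "B = H \<inter> (\<lambda>(t, s, t'). t \<otimes> s \<otimes> inv t') ` (T \<times> S \<times> T)"
  have "finite B" using T(1) A(1) by (auto simp: B_def S_def)
  have BG: "B \<subseteq> carrier G" using subgroup.subset[OF H(1)] by (auto simp: B_def)
  let ?M = "generate G B"
  have M: "subgroup ?M G" by (rule generate_is_subgroup[OF BG])
  have MG: "?M \<subseteq> carrier G" by (rule subgroup.subset[OF M])
  have TG: "T \<subseteq> carrier G" using T(2) KG by blast
  \<comment> \<open>\<open>N\<close> absorbs right multiplication by letters, hence contains
    \<open>?K\<close>. An element of \<open>H\<close> written as \<open>m \<otimes> t\<close> then
    forces \<open>t\<close> into \<open>H\<close>, hence into \<open>B\<close>.\<close>
  define N where "N = {m \<otimes> t | m t. m \<in> ?M \<and> t \<in> T}"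
  have NG: "N \<subseteq> carrier G" using MG TG by (auto simp: N_def)
  have step: "n \<otimes> s \<in> N" if n: "n \<in> N" and s: "s \<in> S" for n s
  proof -
    obtain m t where mt: "n = m \<otimes> t" "m \<in> ?M" "t \<in> T" using n by (auto simp: N_def)
    have "t \<otimes> s \<in> ?K" using mt(3) T(2) s SK by (auto intro: generate.eng)
    then obtain t' where t': "t' \<in> T" "t \<otimes> s \<otimes> inv t' \<in> H" using T(4) by blast
    then have "t \<otimes> s \<otimes> inv t' \<in> B" using mt s by (force simp: B_def)
    then have "m \<otimes> (t \<otimes> s \<otimes> inv t') \<in> ?M" using mt(2) by (blast intro: generate.intros)
    moreover have "n \<otimes> s = m \<otimes> (t \<otimes> s \<otimes> inv t') \<otimes> t'"
    proof -
      have "m \<in> carrier G" "t \<in> carrier G" "s \<in> carrier G" "t' \<in> carrier G"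
        using mt MG TG t'(1) s SK KG by auto
      then show ?thesis using mt(1) by (simp add: m_assoc)
    qed
    ultimately show ?thesis using t'(1) by (auto simp: N_def)
  qed
  have gen: "\<forall>n\<in>N. n \<otimes> g \<in> N" if "g \<in> ?K" for g
    using that
  proof (induction g rule: generate.induct)
    case one
    then show ?case using NG by auto
  next
    case (incl h)
    then show ?case using step by (auto simp: S_def)
  next
    case (inv h)
    then show ?case using step by (auto simp: S_def)
  next
    case (eng h1 h2)
    have "n \<otimes> (h1 \<otimes> h2) = n \<otimes> h1 \<otimes> h2" if "n \<in> N" for n
      using that NG KG eng(1,2) by (simp add: m_assoc subset_iff)
    then show ?case using eng by auto
  qed
  have "\<one> = \<one> \<otimes> \<one>" by simp
  then have oneN: "\<one> \<in> N" using T(3) generate.one unfolding N_def by blast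
  have "?M \<subseteq> H" by (rule generate_subgroup_incl[OF _ H(1)]) (auto simp: B_def)
  have "H \<subseteq> ?M"
  proof
    fix g assume g: "g \<in> H"
    then have gK: "g \<in> ?K" using H(2) by blast
    then have "\<one> \<otimes> g \<in> N" using gen oneN by blast
    then have "g \<in> N" using gK KG by auto
    then obtain m t where mt: "g = m \<otimes> t" "m \<in> ?M" "t \<in> T" by (auto simp: N_def)
    have mt': "m \<in> carrier G" "t \<in> carrier G" using mt MG TG by auto
    then have t: "t = inv m \<otimes> g" using mt(1) by (simp add: m_assoc[symmetric])
    have "m \<in> H" using mt(2) \<open>?M \<subseteq> H\<close> by blast
    then have "t \<in> H" unfolding t
      using g H(1) by (simp add: subgroup.m_closed subgroup.m_inv_closed)
    moreover have "t = t \<otimes> \<one> \<otimes> inv \<one>" using mt' by simp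
    ultimately have "t \<in> B" using mt(3) T(3) unfolding B_def S_def by force
    then show "g \<in> ?M" using mt by (auto intro: generate.intros)
  qed
  then show ?thesis using \<open>finite B\<close> \<open>?M \<subseteq> H\<close> by (intro exI[of _ B]) (auto simp: B_def)
qed

end

section \<open>The group of interval exchanges\<close>

text \<open>Connectedness of a segment, in the form used for continuation: a map that translates
  near each point translates along the whole segment, once the parameter has been subtracted from
  it.\<close>

lemma locally_constant_imp_eq:
  fixes f :: "real \<Rightarrow> 'b"
  assumes "a \<le> b"
    and loc: "\<And>t. a \<le> t \<Longrightarrow> t \<le> b \<Longrightarrow> \<exists>\<delta>>0. \<forall>u. \<bar>u\<bar> < \<delta> \<longrightarrow> a \<le> t + u \<longrightarrow> t + u \<le> b \<longrightarrow> f (t + u) = f t"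
  shows "f a = f b"
proof (rule connected_local_const[of "{a..b}"])
  show "\<forall>t\<in>{a..b}. eventually (\<lambda>s. f t = f s) (at t within {a..b})"
  proof
    fix t assume t: "t \<in> {a..b}"
    then obtain \<delta> where \<delta>: "\<delta> > 0" "\<And>u. \<bar>u\<bar> < \<delta> \<Longrightarrow> a \<le> t + u \<Longrightarrow> t + u \<le> b \<Longrightarrow> f (t + u) = f t"
      using loc[of t] by auto
    show "eventually (\<lambda>s. f t = f s) (at t within {a..b})"
      unfolding eventually_at
    proof (intro exI[of _ \<delta>] conjI ballI impI)
      fix s assume "s \<in> {a..b}" "s \<noteq> t \<and> dist s t < \<delta>"
      then show "f t = f s" using \<delta>(2)[of "s - t"] by (auto simp: dist_real_def)
    qed (use \<delta> in auto)
  qed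
qed (use assms(1) in auto)

section \<open>Movement along a component and its left end\<close>

lemma shift_shift [simp]: "shift C (shift C p t) u = shift C p (t + u)"
proof (cases "snd (C ! fst p) = 0")
  case False
  then show ?thesis
    by (simp add: shift_def add_divide_distrib algebra_simps)
qed (simp add: shift_def)

lemma fst_shift [simp]: "fst (shift C p t) = fst p"
  by (simp add: shift_def)

lemma shift_eq_plain:
  assumes "0 \<le> snd p + t" "snd p + t < snd (C ! fst p)"
  shows "shift C p t = (fst p, snd p + t)"
proof -
  have "frac ((snd p + t) / snd (C ! fst p)) = (snd p + t) / snd (C ! fst p)"
    using assms by (subst frac_eq) auto
  then show ?thesis using assms by (auto simp: shift_def)
qed

lemma shift_0: "p \<in> dpts C \<Longrightarrow> shift C p 0 = p"
  by (subst shift_eq_plain) (auto simp: dpts_def)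

lemma shift_inj:
  assumes "shift C p u = shift C p v" "\<bar>u - v\<bar> < snd (C ! fst p)"
  shows "u = v"
proof (cases "fst (C ! fst p)")
  case True
  let ?L = "snd (C ! fst p)"
  have L: "?L > 0" using assms(2) by linarith
  have "frac ((snd p + u) / ?L) = frac ((snd p + v) / ?L)"
    using assms(1) True L by (simp add: shift_def)
  then obtain n where "(snd p + u) / ?L = (snd p + v) / ?L + of_int n"
    by (rule frac_eqE)
  then have n: "u - v = of_int n * ?L" using L by (simp add: field_simps)
  have "\<bar>of_int n\<bar> * ?L < 1 * ?L" using assms(2) L unfolding n by (simp add: abs_mult)
  then have "\<bar>of_int n :: real\<bar> < 1" using L by (subst (asm) mult_less_cancel_right_pos) auto
  then have "n = 0" by linarith
  then show ?thesis using n by simp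
qed (use assms in \<open>simp add: shift_def\<close>)

definition left_ends :: "dom_desc \<Rightarrow> dpt set" where
  "left_ends C = {p \<in> dpts C. \<not> fst (C ! fst p) \<and> snd p = 0}"

lemma left_ends_subset: "left_ends C \<subseteq> dpts C"
  by (auto simp: left_ends_def)

lemma finite_origins: "finite {p \<in> dpts C. snd p = 0}"
  by (rule finite_subset[of _ "(\<lambda>i. (i, 0)) ` {..<length C}"]) (auto simp: dpts_def)

lemma finite_left_ends: "finite (left_ends C)"
  by (rule finite_subset[OF _ finite_origins]) (auto simp: left_ends_def)

lemma shift_in_dpts_near:
  assumes "p \<in> dpts C" "p \<notin> left_ends C"
  shows "\<exists>\<delta>>0. \<forall>t. \<bar>t\<bar> < \<delta> \<longrightarrow> shift C p t \<in> dpts C"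
proof (cases "fst (C ! fst p)")
  case True
  have L: "snd (C ! fst p) > 0" "fst p < length C" using assms by (auto simp: dpts_def)
  have "shift C p t \<in> dpts C" for t
    using True L frac_lt_1[of "(snd p + t) / snd (C ! fst p)"] by (auto simp: shift_def dpts_def)
  then show ?thesis by (auto intro: exI[of _ 1])
next
  case False
  then have "snd p > 0" "snd p < snd (C ! fst p)" "fst p < length C"
    using assms by (auto simp: left_ends_def dpts_def)
  then show ?thesis using False
    by (intro exI[of _ "min (snd p) (snd (C ! fst p) - snd p)"]) (auto simp: shift_def dpts_def)
qed

lemma left_end_shift_nonpos:
  assumes "p \<in> left_ends C" "t \<le> 0" "shift C p t \<in> dpts C"
  shows "t = 0"
  using assms by (auto simp: left_ends_def shift_def dpts_def)

lemma iet_bij_betw: "iet C f \<Longrightarrow> bij_betw f (dpts C) (dpts C)"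
  by (simp add: iet_def)

lemma iet_in_dpts: "iet C f \<Longrightarrow> p \<in> dpts C \<Longrightarrow> f p \<in> dpts C"
  using iet_bij_betw bij_betwE by blast

lemma iet_outside: "iet C f \<Longrightarrow> p \<notin> dpts C \<Longrightarrow> f p = p"
  unfolding iet_def by blast

lemma iet_surj: "iet C f \<Longrightarrow> q \<in> dpts C \<Longrightarrow> \<exists>p\<in>dpts C. q = f p"
  using iet_bij_betw[of C f] unfolding bij_betw_def by blast

lemma iet_bij:
  assumes "iet C f" shows "bij f"
proof -
  have "bij_betw f (- dpts C) (- dpts C)"
    using iet_outside[OF assms] by (auto simp: bij_betw_def inj_on_def image_def)
  then have "bij_betw f (dpts C \<union> - dpts C) (dpts C \<union> - dpts C)"
    by (intro bij_betw_combine[OF iet_bij_betw[OF assms]]) auto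
  then show ?thesis by simp
qed

text \<open>The exact form of left continuity: \<open>left_cont\<close> only bounds a displacement,
  but together with the finiteness of the exceptional set it yields a true translation on the left,
  even at discontinuities.\<close>

definition left_transl :: "dom_desc \<Rightarrow> (dpt \<Rightarrow> dpt) \<Rightarrow> dpt \<Rightarrow> bool" where
  "left_transl C f p \<longleftrightarrow> (\<exists>\<delta>>0. \<forall>t. -\<delta> < t \<and> t \<le> 0 \<and> shift C p t \<in> dpts C \<longrightarrow>
       f (shift C p t) = shift C (f p) t)"

text \<open>Points are separated: a nonzero displacement \<open>u\<close> from \<open>q\<close> to
  \<open>c\<close> would have to equal a strictly smaller one, by injectivity of
  \<open>shift\<close> within less than one turn.\<close>

lemma shift_arbitrarily_small_imp_eq:
  assumes q: "q \<in> dpts C" and small: "\<And>\<epsilon>. \<epsilon> > 0 \<Longrightarrow> \<exists>u. \<bar>u\<bar> < \<epsilon> \<and> c = shift C q u"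
  shows "c = q"
proof -
  let ?L = "snd (C ! fst q)"
  have L: "?L > 0" using q by (auto simp: dpts_def)
  obtain u where u: "\<bar>u\<bar> < ?L / 2" "c = shift C q u" using small[of "?L / 2"] L by auto
  show ?thesis
  proof (cases "u = 0")
    case True then show ?thesis using u shift_0[OF q] by simp
  next
    case False
    then obtain v where v: "\<bar>v\<bar> < \<bar>u\<bar>" "c = shift C q v" using small[of "\<bar>u\<bar>"] by auto
    have "u = v" by (rule shift_inj[of C q]) (use u v in auto)
    then show ?thesis using v by simp
  qed
qed

text \<open>A short open segment to the left of \<open>p\<close> avoids the exceptional points, so
  \<open>f\<close> is one translation there; left continuity identifies its limit at
  \<open>p\<close> with \<open>f p\<close>. At a left end only the parameter 0 is left to
  check.\<close>

lemma iet_left_transl: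
  assumes f: "iet C f" and p: "p \<in> dpts C"
  shows "left_transl C f p"
proof (cases "p \<in> left_ends C")
  case True
  then show ?thesis
    using shift_0[OF p] shift_0[OF iet_in_dpts[OF f p]] left_end_shift_nonpos[OF True]
    unfolding left_transl_def by (intro exI[of _ 1]) force
next
  case False
  obtain \<delta>0 where \<delta>0: "\<delta>0 > 0" "\<And>t. \<bar>t\<bar> < \<delta>0 \<Longrightarrow> shift C p t \<in> dpts C"
    using shift_in_dpts_near[OF p False] by auto
  obtain S where S: "finite S" "\<And>q. q \<in> dpts C - S \<Longrightarrow> loc_transl C f q"
    using f by (auto simp: iet_def)
  let ?L = "snd (C ! fst p)"
  have L: "?L > 0" using p by (auto simp: dpts_def)
  \<comment> \<open>The bound \<open>?L\<close> keeps \<open>shift C p\<close> injective on the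
    range, also on a circle, so finitely many bad points mean finitely many bad parameters.\<close>
  define \<delta>1 where "\<delta>1 = min \<delta>0 ?L"
  have \<delta>1: "\<delta>1 > 0" using \<delta>0 L by (simp add: \<delta>1_def)
  define B where "B = {t. -\<delta>1 < t \<and> t < 0 \<and> shift C p t \<in> S \<union> left_ends C}"
  have "inj_on (shift C p) B"
    by (rule inj_onI, rule shift_inj[of C p]) (auto simp: B_def \<delta>1_def)
  moreover have "finite (shift C p ` B)"
    by (rule finite_subset[of _ "S \<union> left_ends C"]) (auto simp: B_def S finite_left_ends)
  ultimately have finB: "finite B" using finite_image_iff by blast
  define \<delta> where "\<delta> = Min (insert \<delta>1 (uminus ` B))"
  have \<delta>: "\<delta> > 0" "\<delta> \<le> \<delta>1" "\<And>t. t \<in> B \<Longrightarrow> \<delta> \<le> -t"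
    using finB \<delta>1 by (auto simp: \<delta>_def B_def)
  have ok: "shift C p t \<in> dpts C" "loc_transl C f (shift C p t)" "shift C p t \<notin> left_ends C"
    if "-\<delta> < t" "t < 0" for t
  proof -
    have "t \<notin> B" using \<delta>(3)[of t] that by auto
    then have "shift C p t \<notin> S \<union> left_ends C" using that \<delta> by (auto simp: B_def)
    moreover show "shift C p t \<in> dpts C" using that \<delta> \<delta>0 by (auto simp: \<delta>1_def)
    ultimately show "loc_transl C f (shift C p t)" "shift C p t \<notin> left_ends C" using S by auto
  qed
  \<comment> \<open>Undoing the parameter turns translation into constancy; the constant is the
    candidate for \<open>f p\<close>.\<close>
  define \<Phi> where "\<Phi> = (\<lambda>t. shift C (f (shift C p t)) (- t))"
  have const: "\<Phi> a = \<Phi> b" if ab: "-\<delta> < a" "a \<le> b" "b < 0" for a b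
  proof (rule locally_constant_imp_eq[OF ab(2)])
    fix t assume t: "a \<le> t" "t \<le> b"
    then have t': "-\<delta> < t" "t < 0" using ab by auto
    obtain \<epsilon> where \<epsilon>: "\<epsilon> > 0" "\<And>u. \<bar>u\<bar> < \<epsilon> \<Longrightarrow> shift C (shift C p t) u \<in> dpts C \<Longrightarrow>
        f (shift C (shift C p t) u) = shift C (f (shift C p t)) u"
      using ok(2)[OF t'] unfolding loc_transl_def by blast
    show "\<exists>\<delta>>0. \<forall>u. \<bar>u\<bar> < \<delta> \<longrightarrow> a \<le> t + u \<longrightarrow> t + u \<le> b \<longrightarrow> \<Phi> (t + u) = \<Phi> t"
    proof (intro exI[of _ \<epsilon>] conjI allI impI)
      fix u assume u: "\<bar>u\<bar> < \<epsilon>" "a \<le> t + u" "t + u \<le> b"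
      have "f (shift C p (t + u)) = shift C (f (shift C p t)) u"
        using \<epsilon>(2)[OF u(1)] ok(1)[of "t + u"] u ab by simp
      then show "\<Phi> (t + u) = \<Phi> t" by (simp add: \<Phi>_def)
    qed (use \<epsilon> in auto)
  qed
  define c where "c = \<Phi> (-\<delta> / 2)"
  have fc: "f (shift C p t) = shift C c t" if t: "-\<delta> < t" "t < 0" for t
  proof -
    have "\<Phi> t = c" using const[of t "-\<delta>/2"] const[of "-\<delta>/2" t] t \<delta>(1) unfolding c_def
      by (cases "t \<le> -\<delta>/2") auto
    then have "shift C c t = shift C (f (shift C p t)) 0" by (auto simp: \<Phi>_def)
    then show ?thesis using shift_0[OF iet_in_dpts[OF f ok(1)[OF t]]] by simp
  qed
  have c0: "shift C c 0 = c" by (simp add: c_def \<Phi>_def)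
  have "c = f p"
  proof (rule shift_arbitrarily_small_imp_eq[OF iet_in_dpts[OF f p]])
    fix \<epsilon> :: real assume \<epsilon>: "\<epsilon> > 0"
    obtain d where d: "d > 0" "\<And>t. -d < t \<Longrightarrow> t \<le> 0 \<Longrightarrow> shift C p t \<in> dpts C \<Longrightarrow>
        \<exists>s. \<bar>s\<bar> < \<epsilon> / 2 \<and> f (shift C p t) = shift C (f p) s"
      using f p \<epsilon> half_gt_zero[OF \<epsilon>] unfolding iet_def left_cont_def by metis
    \<comment> \<open>All three ranges are respected at once: \<open>c\<close> differs from
      \<open>f p\<close> by \<open>s - t\<close>, and each of \<open>s\<close> and \<open>t\<close>
      contributes at most \<epsilon>/2.\<close>
    define t where "t = - min (d / 2) (min (\<epsilon> / 2) (\<delta> / 2))"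
    have t: "-\<delta> < t" "t < 0" "-d < t" "\<bar>t\<bar> \<le> \<epsilon> / 2"
      using \<delta>(1) d \<epsilon> by (auto simp: t_def min_def)
    obtain s where s: "\<bar>s\<bar> < \<epsilon> / 2" "f (shift C p t) = shift C (f p) s"
      using d(2)[of t] t ok(1)[of t] by auto
    have "shift C (shift C c t) (-t) = shift C (f p) (s - t)"
      using s fc[of t] t by simp
    then have "c = shift C (f p) (s - t)" using c0 by simp
    then show "\<exists>u. \<bar>u\<bar> < \<epsilon> \<and> c = shift C (f p) u" using s t by (intro exI[of _ "s - t"]) auto
  qed
  then have "f (shift C p t) = shift C (f p) t" if t: "-\<delta> < t" "t \<le> 0" for t
    using t fc[of t] c0 shift_0[OF p] by (cases "t = 0") auto
  then show ?thesis unfolding left_transl_def using \<delta>(1) by blast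
qed

lemma loc_transl_imp_cont_at: "loc_transl C f p \<Longrightarrow> cont_at C f p"
proof -
  assume "loc_transl C f p"
  then obtain d where d: "d > 0" "\<And>t. \<bar>t\<bar> < d \<Longrightarrow> shift C p t \<in> dpts C \<Longrightarrow> f (shift C p t) = shift C (f p) t"
    unfolding loc_transl_def by blast
  show ?thesis unfolding cont_at_def
  proof (intro allI impI)
    fix \<epsilon> :: real assume "\<epsilon> > 0"
    then show "\<exists>\<delta>>0. \<forall>t. \<bar>t\<bar> < \<delta> \<and> shift C p t \<in> dpts C \<longrightarrow> (\<exists>s. \<bar>s\<bar> < \<epsilon> \<and> f (shift C p t) = shift C (f p) s)"
      using d by (intro exI[of _ "min d \<epsilon>"]) auto
  qed
qed

lemma left_transl_imp_left_cont: "left_transl C f p \<Longrightarrow> left_cont C f p"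
proof -
  assume "left_transl C f p"
  then obtain d where d: "d > 0" "\<And>t. -d < t \<Longrightarrow> t \<le> 0 \<Longrightarrow> shift C p t \<in> dpts C \<Longrightarrow> f (shift C p t) = shift C (f p) t"
    unfolding left_transl_def by blast
  show ?thesis unfolding left_cont_def
  proof (intro allI impI)
    fix \<epsilon> :: real assume "\<epsilon> > 0"
    have "\<bar>t\<bar> < \<epsilon> \<and> f (shift C p t) = shift C (f p) t"
      if "- min d \<epsilon> < t \<and> t \<le> 0 \<and> shift C p t \<in> dpts C" for t
      using d(2)[of t] that by auto
    then show "\<exists>\<delta>>0. \<forall>t. -\<delta> < t \<and> t \<le> 0 \<and> shift C p t \<in> dpts C \<longrightarrow> (\<exists>s. \<bar>s\<bar> < \<epsilon> \<and> f (shift C p t) = shift C (f p) s)"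
      using d(1) \<open>\<epsilon> > 0\<close> by (intro exI[of _ "min d \<epsilon>"] conjI) (simp, blast)
  qed
qed

section \<open>Closure under composition and inversion\<close>

lemma ietI:
  assumes "bij_betw f (dpts C) (dpts C)" "\<And>p. p \<notin> dpts C \<Longrightarrow> f p = p"
    and fin: "finite S" "\<And>p. p \<in> dpts C - S \<Longrightarrow> loc_transl C f p"
    and "\<And>p. p \<in> dpts C \<Longrightarrow> left_transl C f p"
  shows "iet C f"
proof -
  have "finite {p \<in> dpts C. \<not> cont_at C f p}"
    by (rule finite_subset[OF _ fin(1)]) (use fin(2) loc_transl_imp_cont_at in blast)
  then show ?thesis unfolding iet_def using assms left_transl_imp_left_cont by blast
qed

lemma iet_id: "iet C id"
  by (rule ietI[of _ _ "{}"]) (auto simp: loc_transl_def left_transl_def intro: exI[of _ 1])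

lemma iet_finite_bad:
  assumes "iet C f" shows "finite {p \<in> dpts C. \<not> loc_transl C f p}"
proof -
  obtain S where "finite S" "\<And>q. q \<in> dpts C - S \<Longrightarrow> loc_transl C f q"
    using assms by (auto simp: iet_def)
  then show ?thesis by (elim finite_subset[rotated]) blast
qed

lemma iet_comp:
  assumes f: "iet C f" and g: "iet C g"
  shows "iet C (f \<circ> g)"
proof (rule ietI[of _ _ "{p \<in> dpts C. \<not> loc_transl C g p} \<union> g -` {p \<in> dpts C. \<not> loc_transl C f p}"])
  show "bij_betw (f \<circ> g) (dpts C) (dpts C)"
    using f g iet_bij_betw bij_betw_trans by blast
  show "(f \<circ> g) p = p" if "p \<notin> dpts C" for p using that f g by (simp add: iet_outside)
  show "finite ({p \<in> dpts C. \<not> loc_transl C g p} \<union> g -` {p \<in> dpts C. \<not> loc_transl C f p})"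
    using iet_finite_bad[OF f] iet_finite_bad[OF g] bij_is_inj[OF iet_bij[OF g]]
    by (intro finite_UnI finite_vimageI)
next
  fix p assume p: "p \<in> dpts C - ({p \<in> dpts C. \<not> loc_transl C g p} \<union> g -` {p \<in> dpts C. \<not> loc_transl C f p})"
  then have p': "p \<in> dpts C" "g p \<in> dpts C" using iet_in_dpts[OF g] by auto
  have "loc_transl C g p" "loc_transl C f (g p)" using p p' by auto
  then obtain d e where "d > 0" "\<And>t. \<bar>t\<bar> < d \<Longrightarrow> shift C p t \<in> dpts C \<Longrightarrow> g (shift C p t) = shift C (g p) t"
    "e > 0" "\<And>t. \<bar>t\<bar> < e \<Longrightarrow> shift C (g p) t \<in> dpts C \<Longrightarrow> f (shift C (g p) t) = shift C (f (g p)) t"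
    unfolding loc_transl_def by metis
  then show "loc_transl C (f \<circ> g) p" unfolding loc_transl_def
    by (intro exI[of _ "min d e"]) (auto, metis iet_in_dpts[OF g])
next
  fix p assume p: "p \<in> dpts C"
  then have "left_transl C g p" "left_transl C f (g p)" using iet_left_transl iet_in_dpts f g by auto
  then obtain d e where "d > 0" "\<And>t. -d < t \<Longrightarrow> t \<le> 0 \<Longrightarrow> shift C p t \<in> dpts C \<Longrightarrow> g (shift C p t) = shift C (g p) t"
    "e > 0" "\<And>t. -e < t \<Longrightarrow> t \<le> 0 \<Longrightarrow> shift C (g p) t \<in> dpts C \<Longrightarrow> f (shift C (g p) t) = shift C (f (g p)) t"
    unfolding left_transl_def by metis
  moreover from this have "(f \<circ> g) (shift C p t) = shift C ((f \<circ> g) p) t"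
    if "- min d e < t" "t \<le> 0" "shift C p t \<in> dpts C" for t
  proof -
    have t: "- d < t" "- e < t" using that by auto
    then have "g (shift C p t) = shift C (g p) t" using calculation(2) that by blast
    then show ?thesis using calculation(4)[OF t(2)] iet_in_dpts[OF g that(3)] that by simp
  qed
  ultimately show "left_transl C (f \<circ> g) p" unfolding left_transl_def
    by (intro exI[of _ "min d e"]) auto
qed

text \<open>A point that is not a left end can be approached from the left and so can its image; hence
  the finite set of left ends is carried onto itself. This is why the inverse is left-continuous.\<close>

lemma iet_left_ends:
  assumes f: "iet C f" shows "f ` left_ends C = left_ends C"
proof -
  have sub: "left_ends C \<subseteq> f ` left_ends C"
  proof
    fix q assume q: "q \<in> left_ends C"
    then have "q \<in> f ` dpts C" using iet_bij_betw[OF f] left_ends_subset by (auto simp: bij_betw_def)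
    then obtain p where p: "p \<in> dpts C" "q = f p" by blast
    have "p \<in> left_ends C"
    proof (rule ccontr)
      assume "p \<notin> left_ends C"
      then obtain d where d: "d > 0" "\<And>t. \<bar>t\<bar> < d \<Longrightarrow> shift C p t \<in> dpts C"
        using shift_in_dpts_near p(1) by blast
      obtain e where e: "e > 0" "\<And>t. -e < t \<Longrightarrow> t \<le> 0 \<Longrightarrow> shift C p t \<in> dpts C \<Longrightarrow> f (shift C p t) = shift C (f p) t"
        using iet_left_transl[OF f p(1)] unfolding left_transl_def by blast
      define t where "t = - min (d/2) (e/2)"
      have t: "\<bar>t\<bar> < d" "-e < t" "t < 0" using d(1) e(1) by (auto simp: t_def min_def)
      have "shift C q t \<in> dpts C"
        using e(2)[of t] d(2)[of t] t iet_in_dpts[OF f d(2)[of t]] p(2) by simp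
      then show False using left_end_shift_nonpos[OF q, of t] t by simp
    qed
    then show "q \<in> f ` left_ends C" using p by blast
  qed
  moreover have "card (f ` left_ends C) \<le> card (left_ends C)"
    by (rule card_image_le[OF finite_left_ends])
  ultimately show ?thesis
    using card_seteq[OF finite_imageI[OF finite_left_ends] sub] by simp
qed

lemma iet_inv:
  assumes f: "iet C f" shows "iet C (inv_into UNIV f)"
proof -
  have bij: "bij f" by (rule iet_bij[OF f])
  then have inv_f: "inv_into UNIV f (f p) = p" for p by (simp add: bij_is_inj)
  \<comment> \<open>At a left end \<open>loc_transl\<close> says nothing about negative parameters,
    so the images of left ends join the finite exceptional set.\<close>
  let ?S = "f ` ({p \<in> dpts C. \<not> loc_transl C f p} \<union> left_ends C)"
  show ?thesis
  proof (rule ietI[of _ _ ?S])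
    have "f ` dpts C = dpts C" using iet_bij_betw[OF f] by (simp add: bij_betw_def)
    then have "inv_into UNIV f ` dpts C = dpts C" using bij by (metis bij_is_inj image_inv_f_f)
    then show "bij_betw (inv_into UNIV f) (dpts C) (dpts C)"
      using bij_is_inj[OF bij_imp_bij_inv[OF bij]] by (auto simp: bij_betw_def inj_on_def)
    show "inv_into UNIV f p = p" if "p \<notin> dpts C" for p using iet_outside[OF f that] inv_f by metis
    show "finite ?S" using iet_finite_bad[OF f] finite_left_ends by blast
  next
    fix q assume q: "q \<in> dpts C - ?S"
    then obtain p where p: "p \<in> dpts C" "q = f p"
      using iet_surj[OF f] by blast
    then have *: "loc_transl C f p" "p \<notin> left_ends C" using q by auto
    obtain d where d: "d > 0" "\<And>t. \<bar>t\<bar> < d \<Longrightarrow> shift C p t \<in> dpts C"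
      using shift_in_dpts_near p(1) *(2) by blast
    obtain e where e: "e > 0" "\<And>t. \<bar>t\<bar> < e \<Longrightarrow> shift C p t \<in> dpts C \<Longrightarrow> f (shift C p t) = shift C (f p) t"
      using *(1) unfolding loc_transl_def by blast
    have "inv_into UNIV f (shift C q t) = shift C (inv_into UNIV f q) t" if "\<bar>t\<bar> < min d e" for t
      using that e(2)[of t] d(2)[of t] p(2) inv_f by (metis min_less_iff_conj)
    then show "loc_transl C (inv_into UNIV f) q" unfolding loc_transl_def
      using d(1) e(1) by (intro exI[of _ "min d e"]) auto
  next
    fix q assume q: "q \<in> dpts C"
    then obtain p where p: "p \<in> dpts C" "q = f p"
      using iet_surj[OF f q] by blast
    show "left_transl C (inv_into UNIV f) q"
    proof (cases "p \<in> left_ends C")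
      case True
      then have "q \<in> left_ends C" using iet_left_ends[OF f] p by blast
      then have "t = 0" if "t \<le> 0" "shift C q t \<in> dpts C" for t
        using left_end_shift_nonpos that by blast
      moreover have "inv_into UNIV f (shift C q 0) = shift C (inv_into UNIV f q) 0"
        using shift_0[OF p(1)] shift_0[OF q] p(2) inv_f by simp
      ultimately show ?thesis
        unfolding left_transl_def by (intro exI[of _ 1]) auto
    next
      case False
      obtain d where d: "d > 0" "\<And>t. \<bar>t\<bar> < d \<Longrightarrow> shift C p t \<in> dpts C"
        using shift_in_dpts_near p(1) False by blast
      obtain e where e: "e > 0" "\<And>t. -e < t \<Longrightarrow> t \<le> 0 \<Longrightarrow> shift C p t \<in> dpts C \<Longrightarrow> f (shift C p t) = shift C (f p) t"
        using iet_left_transl[OF f p(1)] unfolding left_transl_def by blast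
      have "inv_into UNIV f (shift C q t) = shift C (inv_into UNIV f q) t" if "-min d e < t" "t \<le> 0" for t
      proof -
        have "\<bar>t\<bar> < d" "-e < t" using that by auto
        then have "f (shift C p t) = shift C q t" using e(2)[of t] d(2)[of t] that p(2) by simp
        then show ?thesis using inv_f p(2) by metis
      qed
      then show ?thesis unfolding left_transl_def
        using d(1) e(1) by (intro exI[of _ "min d e"]) auto
    qed
  qed
qed

lemma group_iet_group: "group (iet_group C)"
proof (rule groupI)
  fix f assume "f \<in> carrier (iet_group C)"
  then have f: "iet C f" by (simp add: iet_group_def)
  show "\<exists>g\<in>carrier (iet_group C). g \<otimes>\<^bsub>iet_group C\<^esub> f = \<one>\<^bsub>iet_group C\<^esub>"
    using iet_inv[OF f] bij_is_inj[OF iet_bij[OF f]] by (auto simp: iet_group_def)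
qed (auto simp: iet_group_def iet_comp iet_id comp_assoc)

lemma inv_iet_group:
  assumes "iet C f" shows "inv\<^bsub>iet_group C\<^esub> f = inv_into UNIV f"
proof (rule group.inv_equality[OF group_iet_group])
  show "inv_into UNIV f \<otimes>\<^bsub>iet_group C\<^esub> f = \<one>\<^bsub>iet_group C\<^esub>"
    using bij_is_inj[OF iet_bij[OF assms]] by (simp add: iet_group_def)
qed (use assms iet_inv in \<open>auto simp: iet_group_def\<close>)

section \<open>Groups generated by piecewise translations\<close>

definition tr :: "dpt \<Rightarrow> real \<Rightarrow> dpt" where
  "tr p t = (fst p, snd p + t)"

lemma tr_0 [simp]: "tr p 0 = p"
  and tr_tr [simp]: "tr (tr p t) u = tr p (t + u)"
  and fst_tr [simp]: "fst (tr p t) = fst p"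
  and snd_tr [simp]: "snd (tr p t) = snd p + t"
  by (auto simp: tr_def)

lemma tr_inj [simp]: "tr p t = tr p u \<longleftrightarrow> t = u" "tr p t = tr q t \<longleftrightarrow> p = q"
  by (auto simp: tr_def prod_eq_iff)

lemma tr_diff: "fst p = fst q \<Longrightarrow> q = tr p (snd q - snd p)"
  by (simp add: tr_def prod_eq_iff)

lemma mem_dpts: "p \<in> dpts C \<longleftrightarrow> fst p < length C \<and> 0 \<le> snd p \<and> snd p < snd (C ! fst p)"
  by (cases p) (simp add: dpts_def)

text \<open>Circles are cut open at 0: boundaries and regularity refer to the straight translation
  \<^const>\<open>tr\<close> instead of \<^const>\<open>shift\<close>. This only makes the finitely many points with coordinate 0
  irregular.\<close>

definition bd :: "dom_desc \<Rightarrow> dpt set \<Rightarrow> dpt set" where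
  "bd C K = {p \<in> dpts C. \<forall>\<delta>>0. \<exists>t. \<bar>t\<bar> < \<delta> \<and> (tr p t \<in> K) \<noteq> (p \<in> K)}"

definition regular :: "dom_desc \<Rightarrow> (dpt \<Rightarrow> dpt) \<Rightarrow> dpt \<Rightarrow> bool" where
  "regular C f p \<longleftrightarrow> p \<in> dpts C \<and> f p \<in> dpts C \<and>
     (\<exists>\<delta>>0. \<forall>t. \<bar>t\<bar> < \<delta> \<longrightarrow> f (tr p t) = tr (f p) t)"

lemma bd_subset: "bd C K \<subseteq> dpts C"
  by (auto simp: bd_def)

lemma not_bd_iff:
  "p \<in> dpts C \<Longrightarrow> p \<notin> bd C K \<longleftrightarrow> (\<exists>\<delta>>0. \<forall>t. \<bar>t\<bar> < \<delta> \<longrightarrow> (tr p t \<in> K) = (p \<in> K))"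
  by (auto simp: bd_def)

text \<open>Being a boundary point depends only on the germ of the set. The assumption at parameter
  0 already matches the membership of \<open>p\<close> with that of \<open>q\<close>.\<close>

lemma bd_local:
  assumes "p \<in> dpts C" "q \<in> dpts C" "\<delta> > 0"
    and "\<And>t. \<bar>t\<bar> < \<delta> \<Longrightarrow> (tr p t \<in> K) = (tr q t \<in> K')"
  shows "p \<in> bd C K \<longleftrightarrow> q \<in> bd C K'"
proof -
  have *: "y \<notin> bd C Y" if x: "x \<notin> bd C Z" "x \<in> dpts C" and y: "y \<in> dpts C"
    and eq: "\<And>t. \<bar>t\<bar> < \<delta> \<Longrightarrow> (tr x t \<in> Z) = (tr y t \<in> Y)" for x y Z Y
  proof -
    have 0: "(x \<in> Z) = (y \<in> Y)" using eq[of 0] assms(3) by simp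
    obtain e where e: "e > 0" "\<And>t. \<bar>t\<bar> < e \<Longrightarrow> (tr x t \<in> Z) = (x \<in> Z)"
      using x not_bd_iff by blast
    have "(tr y t \<in> Y) = (y \<in> Y)" if "\<bar>t\<bar> < min e \<delta>" for t
      using that e(2)[of t] 0 eq[of t] by auto
    moreover have "min e \<delta> > 0" using e(1) assms(3) by simp
    ultimately show ?thesis using not_bd_iff[OF y] by blast
  qed
  show ?thesis using *[of p K q K'] *[of q K' p K] assms by blast
qed

lemma bd_image_iff:
  assumes "regular C s p" "inj s"
  shows "s p \<in> bd C (s ` K) \<longleftrightarrow> p \<in> bd C K"
proof -
  obtain \<delta> where \<delta>: "\<delta> > 0" "\<And>t. \<bar>t\<bar> < \<delta> \<Longrightarrow> s (tr p t) = tr (s p) t"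
    using assms(1) unfolding regular_def by blast
  show ?thesis
  proof (rule bd_local[OF _ _ \<delta>(1)])
    fix t :: real assume "\<bar>t\<bar> < \<delta>"
    then show "(tr (s p) t \<in> s ` K) = (tr p t \<in> K)"
      using \<delta>(2)[of t, symmetric] assms(2) by (simp add: inj_image_mem_iff)
  qed (use assms(1) in \<open>auto simp: regular_def\<close>)
qed

lemma bd_empty [simp]: "bd C {} = {}"
  by (auto simp: bd_def intro: exI[of _ 1])

lemma bd_Un: "bd C (Z \<union> Y) \<subseteq> bd C Z \<union> bd C Y"
proof
  fix p assume p: "p \<in> bd C (Z \<union> Y)"
  then have pD: "p \<in> dpts C" using bd_subset by blast
  show "p \<in> bd C Z \<union> bd C Y"
  proof (rule ccontr)
    assume "p \<notin> bd C Z \<union> bd C Y"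
    then obtain d e where "d > 0" "\<And>t. \<bar>t\<bar> < d \<Longrightarrow> (tr p t \<in> Z) = (p \<in> Z)"
      "e > 0" "\<And>t. \<bar>t\<bar> < e \<Longrightarrow> (tr p t \<in> Y) = (p \<in> Y)" using not_bd_iff[OF pD] by (metis UnCI)
    then have "\<exists>\<delta>>0. \<forall>t. \<bar>t\<bar> < \<delta> \<longrightarrow> (tr p t \<in> Z \<union> Y) = (p \<in> Z \<union> Y)"
      by (intro exI[of _ "min d e"]) auto
    then show False using p not_bd_iff[OF pD] by blast
  qed
qed

lemma finite_bd_UN:
  assumes "finite I" "\<And>i. i \<in> I \<Longrightarrow> finite (bd C (Z i))"
  shows "finite (bd C (\<Union>i\<in>I. Z i))"
  using assms
proof (induction I rule: finite_induct)
  case (insert i I)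
  then show ?case using finite_subset[OF bd_Un[of C "Z i" "\<Union>i\<in>I. Z i"]] by simp
qed simp

text \<open>Only \<open>Inf T\<close> and \<open>Sup T\<close> can give boundary points. Arguing
  with these two numbers treats open, closed and half-open segments alike, since later
  \<open>T\<close> is merely known to be convex and bounded.\<close>

lemma finite_bd_slice:
  assumes conv: "\<And>a b c. a \<in> T \<Longrightarrow> b \<in> T \<Longrightarrow> a \<le> c \<Longrightarrow> c \<le> b \<Longrightarrow> c \<in> T"
    and bdd: "bdd_below T" "bdd_above T"
  shows "finite (bd C (tr q ` T))"
proof (cases "T = {}")
  case False
  have "bd C (tr q ` T) \<subseteq> {tr q (Inf T), tr q (Sup T)}"
  proof
    fix p assume p: "p \<in> bd C (tr q ` T)"
    then have pD: "p \<in> dpts C" using bd_subset by blast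
    show "p \<in> {tr q (Inf T), tr q (Sup T)}"
    proof (rule ccontr)
      assume n: "p \<notin> {tr q (Inf T), tr q (Sup T)}"
      have "\<exists>\<delta>>0. \<forall>t. \<bar>t\<bar> < \<delta> \<longrightarrow> (tr p t \<in> tr q ` T) = (p \<in> tr q ` T)"
      proof (cases "fst p = fst q")
        case False
        then have "tr p t \<notin> tr q ` T" for t by (metis fst_tr imageE)
        from this this[of 0] show ?thesis by (auto intro: exI[of _ 1])
      next
        case True
        define c where "c = snd p - snd q"
        have pc: "p = tr q c" using True tr_diff c_def by metis
        have mem: "tr q x \<in> tr q ` T \<longleftrightarrow> x \<in> T" for x by auto
        have "c \<noteq> Inf T" "c \<noteq> Sup T" using n pc by auto
        then consider "c < Inf T" | "c > Sup T" | "Inf T < c" "c < Sup T" by linarith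
        then have "\<exists>\<delta>>0. \<forall>t. \<bar>t\<bar> < \<delta> \<longrightarrow> (c + t \<in> T) = (c \<in> T)"
        proof cases
          case 1
          then have "c + t \<notin> T" if "\<bar>t\<bar> < Inf T - c" for t
            using that cInf_lower[OF _ bdd(1), of "c + t"] by fastforce
          from this this[of 0] 1 show ?thesis by (intro exI[of _ "Inf T - c"]) auto
        next
          case 2
          then have "c + t \<notin> T" if "\<bar>t\<bar> < c - Sup T" for t
            using that cSup_upper[OF _ bdd(2), of "c + t"] by fastforce
          from this this[of 0] 2 show ?thesis by (intro exI[of _ "c - Sup T"]) auto
        next
          case 3
          then obtain a b where ab: "a \<in> T" "a < c" "b \<in> T" "c < b"
            using cInf_less_iff[OF False bdd(1)] less_cSup_iff[OF False bdd(2)]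
            by (metis \<open>T \<noteq> {}\<close> bdd cInf_less_iff less_cSup_iff)
          have "c + t \<in> T" if "\<bar>t\<bar> < min (c - a) (b - c)" for t
            by (rule conv[OF ab(1,3)]) (use that in auto)
          from this this[of 0] ab show ?thesis by (intro exI[of _ "min (c - a) (b - c)"]) auto
        qed
        then show ?thesis by (simp add: pc mem del: image_iff)
      qed
      then show False using p not_bd_iff[OF pD] by blast
    qed
  qed
  then show ?thesis by (rule finite_subset) simp
qed simp

text \<open>\<open>Q\<close> cuts the components into finitely many segments on which membership in
  \<open>K\<close> cannot change, so \<open>K\<close> is determined by its trace on \<open>Q\<close>
  and by the segments that it meets.\<close>

lemma finite_sets_bd_subset:
  assumes Q: "finite Q"
  shows "finite {K. K \<subseteq> dpts C \<and> bd C K \<subseteq> Q}" (is "finite ?S")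
proof -
  \<comment> \<open>On one component, two points off \<open>Q\<close> get the same
    \<open>key\<close> exactly when no point of \<open>Q\<close> lies between them.\<close>
  define key where "key p = (fst p, {q \<in> Q. fst q = fst p \<and> snd q < snd p})" for p :: dpt
  have sat': "(p \<in> K) = (p' \<in> K)" if "K \<in> ?S" and p: "p \<in> dpts C" "p \<notin> Q" and p': "p' \<in> dpts C" "p' \<notin> Q"
    and key: "key p = key p'" and le: "snd p \<le> snd p'" for K p p'
  proof -
    have fst: "fst p = fst p'" using key by (simp add: key_def)
    have "((fst p, snd p) \<in> K) = ((fst p, snd p') \<in> K)"
    proof (rule locally_constant_imp_eq[OF le])
      fix t assume t: "snd p \<le> t" "t \<le> snd p'"
      have tD: "(fst p, t) \<in> dpts C" using t p p' fst by (auto simp: mem_dpts)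
      have "(fst p, t) \<notin> Q"
      proof
        assume tQ: "(fst p, t) \<in> Q"
        then have "t \<noteq> snd p'" using p'(2) fst by (metis prod.collapse)
        then have "(fst p, t) \<in> snd (key p')" using t tQ fst by (simp add: key_def)
        then have "(fst p, t) \<in> snd (key p)" using key by simp
        then show False using t by (simp add: key_def)
      qed
      then have "(fst p, t) \<notin> bd C K" using that(1) by auto
      then obtain \<delta> where "\<delta> > 0" "\<And>u. \<bar>u\<bar> < \<delta> \<Longrightarrow> (tr (fst p, t) u \<in> K) = ((fst p, t) \<in> K)"
        using not_bd_iff[OF tD] by blast
      then show "\<exists>\<delta>>0. \<forall>u. \<bar>u\<bar> < \<delta> \<longrightarrow> snd p \<le> t + u \<longrightarrow> t + u \<le> snd p' \<longrightarrow>
          ((fst p, t + u) \<in> K) = ((fst p, t) \<in> K)"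
        by (auto simp: tr_def)
    qed
    then show ?thesis using fst by (metis prod.collapse)
  qed
  have sat: "(p \<in> K) = (p' \<in> K)" if "K \<in> ?S" "p \<in> dpts C" "p \<notin> Q" "p' \<in> dpts C" "p' \<notin> Q"
    "key p = key p'" for K p p'
    using sat'[OF that] sat'[OF that(1,4,5,2,3) that(6)[symmetric]] by linarith
  define \<phi> where "\<phi> K = (K \<inter> Q, key ` (K - Q))" for K
  have "K \<subseteq> K'" if "K \<in> ?S" "K' \<in> ?S" "\<phi> K = \<phi> K'" for K K'
  proof
    fix p assume p: "p \<in> K"
    show "p \<in> K'"
    proof (cases "p \<in> Q")
      case True
      then show ?thesis using that(3) p by (auto simp: \<phi>_def)
    next
      case False
      then have "key p \<in> key ` (K' - Q)" using that(3) p by (auto simp: \<phi>_def)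
      then obtain p' where p': "p' \<in> K'" "p' \<notin> Q" "key p = key p'" by blast
      then show ?thesis using sat[OF that(2), of p p'] that(1,2) p False by blast
    qed
  qed
  note sub = this
  have "inj_on \<phi> ?S"
  proof (rule inj_onI)
    fix K K' assume "K \<in> ?S" "K' \<in> ?S" "\<phi> K = \<phi> K'"
    then show "K = K'" by (intro subset_antisym sub[of K K'] sub[of K' K]) (simp only:)+
  qed
  moreover have "\<phi> ` ?S \<subseteq> Pow Q \<times> Pow ({..<length C} \<times> Pow Q)"
    by (auto simp: \<phi>_def key_def mem_dpts subset_iff)
  then have "finite (\<phi> ` ?S)" by (rule finite_subset) (use Q in simp)
  ultimately show ?thesis using finite_image_iff by blast
qed

text \<open>Only products are formed; with a generating set closed under inverses this is the
  generated group. Adding letters on the left lets inductions follow a point along its orbit one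
  generator at a time.\<close>

inductive_set words :: "('a \<Rightarrow> 'a) set \<Rightarrow> ('a \<Rightarrow> 'a) set" for A where
  words_id: "id \<in> words A"
| words_step: "s \<in> A \<Longrightarrow> g \<in> words A \<Longrightarrow> s \<circ> g \<in> words A"

lemma words_comp: "g \<in> words A \<Longrightarrow> h \<in> words A \<Longrightarrow> g \<circ> h \<in> words A"
  by (induction rule: words.induct) (auto simp: comp_assoc intro: words_step)

lemma words_gen: "s \<in> A \<Longrightarrow> s \<in> words A"
  using words_step[OF _ words_id, of s A] by simp

locale piecewise_translations =
  fixes C :: dom_desc and A :: "(dpt \<Rightarrow> dpt) set"
  assumes finite_gens: "finite A"
    and gens_inv: "s \<in> A \<Longrightarrow> \<exists>s'\<in>A. s' \<circ> s = id \<and> s \<circ> s' = id"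
    and gens_dpts: "s \<in> A \<Longrightarrow> p \<in> dpts C \<Longrightarrow> s p \<in> dpts C"
    and finite_irregular: "s \<in> A \<Longrightarrow> finite {p \<in> dpts C. \<not> regular C s p}"
begin

abbreviation G :: "(dpt \<Rightarrow> dpt) set" where "G \<equiv> words A"

lemma words_inv: "g \<in> G \<Longrightarrow> \<exists>g'\<in>G. g' \<circ> g = id \<and> g \<circ> g' = id"
proof (induction rule: words.induct)
  case words_id
  then show ?case by (intro bexI[of _ id] words.words_id) simp
next
  case (words_step s g)
  then obtain s' g' where *: "s' \<in> A" "s' \<circ> s = id" "s \<circ> s' = id" "g' \<in> G" "g' \<circ> g = id" "g \<circ> g' = id"
    using gens_inv by blast
  then have "g' \<circ> s' \<in> G" using words_comp words_gen by blast
  moreover have "(g' \<circ> s') \<circ> (s \<circ> g) = id" "(s \<circ> g) \<circ> (g' \<circ> s') = id"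
    using * by (metis comp_assoc comp_id)+
  ultimately show ?case by blast
qed

lemma words_inj: "g \<in> G \<Longrightarrow> inj g"
  using words_inv by (metis inj_on_id inj_on_imageI2)

lemma gens_inj: "s \<in> A \<Longrightarrow> inj s"
  by (intro words_inj words_gen)

lemma words_dpts: "g \<in> G \<Longrightarrow> p \<in> dpts C \<Longrightarrow> g p \<in> dpts C"
  by (induction rule: words.induct) (auto simp: gens_dpts)

section \<open>Orbits and the periodic set\<close>

definition orb :: "dpt \<Rightarrow> dpt set" where "orb p = (\<lambda>g. g p) ` G"
definition sorb :: "dpt set \<Rightarrow> dpt set set" where "sorb K = (\<lambda>g. g ` K) ` G"

lemma orb_self: "p \<in> orb p"
  unfolding orb_def by (rule image_eqI[of _ _ id]) (simp_all add: words_id)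

lemma orb_subset_dpts: "p \<in> dpts C \<Longrightarrow> orb p \<subseteq> dpts C"
  by (auto simp: orb_def words_dpts)

lemma orb_sub: "q \<in> orb p \<Longrightarrow> orb q \<subseteq> orb p"
proof -
  assume "q \<in> orb p"
  then obtain g where "g \<in> G" "q = g p" by (auto simp: orb_def)
  then have "h q \<in> orb p" if "h \<in> G" for h
    unfolding orb_def using words_comp[OF that] by (intro image_eqI[of _ _ "h \<circ> g"]) auto
  then show ?thesis by (auto simp: orb_def)
qed

lemma orb_sym: "q \<in> orb p \<Longrightarrow> p \<in> orb q"
proof -
  assume "q \<in> orb p"
  then obtain g where "g \<in> G" "q = g p" by (auto simp: orb_def)
  moreover then obtain g' where "g' \<in> G" "g' \<circ> g = id" using words_inv by blast
  ultimately have "g' q = p" by (metis comp_apply id_apply)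
  then show ?thesis using \<open>g' \<in> G\<close> by (force simp: orb_def)
qed

lemma orb_eq: "q \<in> orb p \<Longrightarrow> orb q = orb p"
  using orb_sub orb_sym by blast

lemma orb_image: "g \<in> G \<Longrightarrow> orb (g p) = orb p"
  by (rule orb_eq) (auto simp: orb_def)

text \<open>Singularities of the generators suffice: along an orbit that avoids them, a word is
  applied letter by letter at regular points.\<close>

definition Sing :: "dpt set" where
  "Sing = {p \<in> dpts C. \<exists>s\<in>A. \<not> regular C s p}"

lemma finite_Sing: "finite Sing"
proof -
  have "Sing = (\<Union>s\<in>A. {p \<in> dpts C. \<not> regular C s p})" by (auto simp: Sing_def)
  then show ?thesis using finite_gens finite_irregular by simp
qed

definition U :: "dpt set" where
  "U = {p \<in> dpts C. finite (orb p) \<and> orb p \<inter> Sing = {}}"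

lemma U_subset: "U \<subseteq> dpts C"
  by (auto simp: U_def)

lemma U_invariant: "g \<in> G \<Longrightarrow> g p \<in> U \<longleftrightarrow> p \<in> U"
proof -
  assume g: "g \<in> G"
  have "g p \<in> dpts C \<longleftrightarrow> p \<in> dpts C"
    using words_dpts[OF g] words_inv[OF g] words_dpts by (metis comp_apply id_apply)
  then show ?thesis using orb_image[OF g] by (auto simp: U_def)
qed

lemma U_image: "g \<in> G \<Longrightarrow> g ` U = U"
proof -
  assume g: "g \<in> G"
  obtain g' where "g \<circ> g' = id" using words_inv[OF g] by blast
  then have "p \<in> g ` U" if "p \<in> U" for p
    using U_invariant[OF g, of "g' p"] that by (metis comp_apply id_apply image_eqI)
  then show ?thesis using U_invariant[OF g] by blast
qed

section \<open>Rigid sliding of finite orbits\<close>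

definition Good :: "dpt \<Rightarrow> real \<Rightarrow> bool" where
  "Good p r \<longleftrightarrow> p \<in> dpts C \<and> 0 < r \<and> finite (orb p) \<and>
     (\<forall>q\<in>orb p. \<forall>t. 0 \<le> t \<and> t < r \<longrightarrow> tr q t \<in> dpts C - Sing)"

text \<open>Every letter of the word acts at a point of the orbit, and \<open>Good\<close> grants
  each orbit point a regular segment of length \<open>r\<close>. Hence the displacement by a letter
  is locally constant along that segment, so constant.\<close>

lemma Good_transport:
  assumes "Good p r" "g \<in> G" "0 \<le> t" "t < r"
  shows "g (tr p t) = tr (g p) t"
  using assms(2)
proof (induction rule: words.induct)
  case (words_step s g)
  let ?q = "g p"
  have q: "?q \<in> orb p" using words_step by (auto simp: orb_def)
  have "tr (s (tr ?q 0)) (- 0) = tr (s (tr ?q t)) (- t)"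
  proof (rule locally_constant_imp_eq[OF assms(3)])
    fix u assume u: "0 \<le> u" "u \<le> t"
    then have "regular C s (tr ?q u)"
      using assms q words_step(1) by (auto simp: Good_def Sing_def)
    then obtain \<delta> where \<delta>: "\<delta> > 0" "\<And>v. \<bar>v\<bar> < \<delta> \<Longrightarrow> s (tr (tr ?q u) v) = tr (s (tr ?q u)) v"
      unfolding regular_def by blast
    show "\<exists>\<delta>>0. \<forall>v. \<bar>v\<bar> < \<delta> \<longrightarrow> 0 \<le> u + v \<longrightarrow> u + v \<le> t \<longrightarrow>
        tr (s (tr ?q (u + v))) (- (u + v)) = tr (s (tr ?q u)) (- u)"
      using \<delta>(1) \<delta>(2)[unfolded tr_tr] by (intro exI[of _ \<delta>]) auto
  qed
  then have "tr (s ?q) t = tr (tr (s (tr ?q t)) (- t)) t" by simp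
  then show ?case using words_step by simp
qed simp

lemma Good_image: "Good p r \<Longrightarrow> q \<in> orb p \<Longrightarrow> Good q r"
  using orb_eq[of q p] orb_subset_dpts[of p] by (auto simp: Good_def)

lemma Good_imp_U: "Good p r \<Longrightarrow> p \<in> U"
  unfolding Good_def U_def by force

text \<open>By transport the orbit of the moved point is the moved orbit: it stays finite, and the
  room left is \<open>r - t\<close>.\<close>

lemma Good_tr:
  assumes "Good p r" "0 \<le> t" "t < r"
  shows "Good (tr p t) (r - t)"
proof -
  have o: "orb (tr p t) = (\<lambda>q. tr q t) ` orb p"
    unfolding orb_def image_image using Good_transport[OF assms(1) _ assms(2,3)] by auto
  then show ?thesis using assms orb_self[of p] unfolding Good_def by (auto simp: o)
qed

text \<open>The right ends lie outside \<open>dpts C\<close>. They are included, for cut-open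
  circles as well, so that every sliding orbit is stopped after a finite time.\<close>

definition barriers :: "dpt set" where
  "barriers = Sing \<union> (\<lambda>i. (i, snd (C ! i))) ` {..<length C}"

lemma finite_barriers: "finite barriers"
  by (simp add: barriers_def finite_Sing)

text \<open>Slide the whole (finite, regular) orbit to the right until one of its points
  first hits a barrier.\<close>

lemma U_reaches_barrier:
  assumes "p \<in> U"
  shows "\<exists>q r. q \<in> orb p \<and> Good p r \<and> tr q r \<in> barriers"
proof -
  have p: "p \<in> dpts C" "finite (orb p)" "orb p \<inter> Sing = {}" using assms by (auto simp: U_def)
  define R where "R = {t. t > 0 \<and> (\<exists>q\<in>orb p. tr q t \<in> barriers)}"
  have "R \<subseteq> (\<lambda>(q, \<sigma>). snd \<sigma> - snd q) ` (orb p \<times> barriers)"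
  proof
    fix t assume "t \<in> R"
    then obtain q where "q \<in> orb p" "tr q t \<in> barriers" by (auto simp: R_def)
    then show "t \<in> (\<lambda>(q, \<sigma>). snd \<sigma> - snd q) ` (orb p \<times> barriers)"
      by (intro image_eqI[of _ _ "(q, tr q t)"]) auto
  qed
  then have finR: "finite R" by (rule finite_subset) (use p finite_barriers in auto)
  \<comment> \<open>The right end of its own component is a barrier for \<open>q\<close>. This makes
    \<open>R\<close> nonempty and keeps the orbit inside the domain up to the time
    \<open>r\<close>.\<close>
  have endR: "snd (C ! fst q) - snd q \<in> R" if "q \<in> orb p" for q
  proof -
    have "q \<in> dpts C" using that orb_subset_dpts p by blast
    moreover from this have "tr q (snd (C ! fst q) - snd q) \<in> barriers"
      by (auto simp: barriers_def tr_def mem_dpts)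
    ultimately show ?thesis using that by (auto simp: R_def mem_dpts)
  qed
  define r where "r = Min R"
  have "R \<noteq> {}" using endR orb_self by blast
  then have r: "r \<in> R" "\<And>t. t \<in> R \<Longrightarrow> r \<le> t" using finR by (auto simp: r_def)
  have "tr q t \<in> dpts C - Sing" if "q \<in> orb p" "0 \<le> t" "t < r" for q t
  proof -
    have q: "q \<in> dpts C" "q \<notin> Sing" using that orb_subset_dpts p by blast+
    have "tr q t \<in> dpts C" using q(1) that r(2)[OF endR[OF that(1)]] by (auto simp: mem_dpts)
    moreover have "tr q t \<notin> Sing"
    proof
      assume *: "tr q t \<in> Sing"
      then have "t \<noteq> 0" using q(2) by auto
      then have "t \<in> R" using * that by (auto simp: R_def barriers_def)
      then show False using r(2) that by fastforce
    qed
    ultimately show ?thesis by blast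
  qed
  then have "Good p r" using r(1) p by (auto simp: Good_def R_def)
  then show ?thesis using r(1) by (auto simp: R_def)
qed

section \<open>The periodic set as finitely many segments\<close>

definition V :: "dpt \<Rightarrow> dpt set" where
  "V \<sigma> = {v. \<exists>r. Good v r \<and> tr v r = \<sigma>}"

lemma V_same_component: "v \<in> V \<sigma> \<Longrightarrow> w \<in> V \<sigma> \<Longrightarrow> fst v = fst w"
  unfolding V_def by (force simp: tr_def)

lemma V_subset_U: "V \<sigma> \<subseteq> U"
  by (auto simp: V_def Good_imp_U)

text \<open>Both points slide to the same \<sigma>, so the room of the left one is \<open>t\<close>
  plus the positive room of the right one. Thus the right point lies on the good segment of the left
  one, which makes \<open>V \<sigma>\<close> convex and moved rigidly.\<close>

lemma V_order:
  assumes "v \<in> V \<sigma>" "tr v t \<in> V \<sigma>" "0 \<le> t"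
  obtains r where "Good v r" "t < r" "tr v r = \<sigma>"
proof -
  obtain r r' where r: "Good v r" "tr v r = \<sigma>" "Good (tr v t) r'" "tr (tr v t) r' = \<sigma>"
    using assms by (auto simp: V_def)
  then have "tr v r = tr v (t + r')" by simp
  then have "r = t + r'" unfolding tr_inj .
  moreover have "r' > 0" using r by (simp add: Good_def)
  ultimately show ?thesis using r that by simp
qed

lemma V_transport:
  assumes "v \<in> V \<sigma>" "tr v t \<in> V \<sigma>" "g \<in> G"
  shows "g (tr v t) = tr (g v) t"
proof (cases "0 \<le> t")
  case True
  obtain r where "Good v r" "t < r" by (rule V_order[OF assms(1,2) True])
  then show ?thesis using Good_transport assms(3) True by blast
next
  case False
  let ?w = "tr v t"
  have v: "v = tr ?w (- t)" by simp
  obtain r where "Good ?w r" "- t < r" by (rule V_order[of ?w \<sigma> "- t"]) (use assms False in auto)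
  then have "g (tr ?w (- t)) = tr (g ?w) (- t)" using Good_transport assms(3) False by simp
  then show ?thesis by simp
qed

text \<open>Any point of \<open>V \<sigma>\<close> serves as origin, because transport works in both
  directions; offsets may therefore be negative. For empty \<open>V \<sigma>\<close> the value is
  arbitrary, and \<open>nonempty_barriers\<close> excludes that case.\<close>

definition base :: "dpt \<Rightarrow> dpt" where "base \<sigma> = (SOME v. v \<in> V \<sigma>)"
definition offsets :: "dpt \<Rightarrow> real set" where "offsets \<sigma> = {t. tr (base \<sigma>) t \<in> V \<sigma>}"
definition nonempty_barriers :: "dpt set" where "nonempty_barriers = {\<sigma> \<in> barriers. V \<sigma> \<noteq> {}}"

lemma base_in_V: "\<sigma> \<in> nonempty_barriers \<Longrightarrow> base \<sigma> \<in> V \<sigma>"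
  unfolding nonempty_barriers_def base_def by (auto intro: someI)

lemma base_transport:
  "\<sigma> \<in> nonempty_barriers \<Longrightarrow> t \<in> offsets \<sigma> \<Longrightarrow> g \<in> G \<Longrightarrow> g (tr (base \<sigma>) t) = tr (g (base \<sigma>)) t"
  using V_transport[OF base_in_V] by (simp add: offsets_def)

lemma offsets_convex:
  assumes "a \<in> offsets \<sigma>" "b \<in> offsets \<sigma>" "a \<le> c" "c \<le> b"
  shows "c \<in> offsets \<sigma>"
proof -
  let ?v = "tr (base \<sigma>) a"
  obtain r where r: "Good ?v r" "b - a < r" "tr ?v r = \<sigma>"
    by (rule V_order[of ?v \<sigma> "b - a"]) (use assms in \<open>auto simp: offsets_def\<close>)
  have "Good (tr ?v (c - a)) (r - (c - a))" by (rule Good_tr[OF r(1)]) (use r(2) assms in auto)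
  then have "tr ?v (c - a) \<in> V \<sigma>" using r(3) unfolding V_def
    by (auto intro!: exI[of _ "r - (c - a)"] simp: add.commute)
  then show ?thesis by (simp add: offsets_def)
qed

lemma offsets_bounded: "bdd_below (offsets \<sigma>)" "bdd_above (offsets \<sigma>)"
proof -
  have "- snd (base \<sigma>) \<le> t \<and> t \<le> snd (C ! fst (base \<sigma>)) - snd (base \<sigma>)" if "t \<in> offsets \<sigma>" for t
  proof -
    have "tr (base \<sigma>) t \<in> dpts C" using that V_subset_U U_subset unfolding offsets_def by blast
    then show ?thesis by (simp add: mem_dpts)
  qed
  then show "bdd_below (offsets \<sigma>)" "bdd_above (offsets \<sigma>)" unfolding bdd_below_def bdd_above_def by blast+
qed

text \<open>Every orbit in \<open>U\<close> has a member \<open>q\<close> that itself runs into a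
  barrier, so \<open>q\<close> lies in some \<open>V \<sigma>\<close>; an element taking
  \<open>q\<close> back to \<open>p\<close> carries the segment along rigidly. All index sets are
  finite and the offsets form a bounded convex set.\<close>

lemma U_eq: "U = (\<Union>\<sigma>\<in>nonempty_barriers. \<Union>q\<in>orb (base \<sigma>). tr q ` offsets \<sigma>)"
proof (intro equalityI subsetI)
  fix p assume "p \<in> U"
  then obtain q r where q: "q \<in> orb p" "Good p r" "tr q r \<in> barriers" using U_reaches_barrier by blast
  define \<sigma> where "\<sigma> = tr q r"
  have qV: "q \<in> V \<sigma>" using Good_image[OF q(2,1)] by (auto simp: V_def \<sigma>_def)
  then have \<sigma>: "\<sigma> \<in> nonempty_barriers" using q(3) by (auto simp: nonempty_barriers_def \<sigma>_def)
  define t where "t = snd q - snd (base \<sigma>)"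
  have qt: "q = tr (base \<sigma>) t"
    unfolding t_def by (rule tr_diff) (use V_same_component qV base_in_V[OF \<sigma>] in blast)
  then have t: "t \<in> offsets \<sigma>" using qV by (simp add: offsets_def)
  obtain g where g: "g \<in> G" "p = g q" using orb_sym[OF q(1)] by (auto simp: orb_def)
  have "p = tr (g (base \<sigma>)) t" using g qt base_transport[OF \<sigma> t] by metis
  moreover have "g (base \<sigma>) \<in> orb (base \<sigma>)" using g(1) by (auto simp: orb_def)
  ultimately show "p \<in> (\<Union>\<sigma>\<in>nonempty_barriers. \<Union>q\<in>orb (base \<sigma>). tr q ` offsets \<sigma>)" using \<sigma> t by blast
next
  fix p assume "p \<in> (\<Union>\<sigma>\<in>nonempty_barriers. \<Union>q\<in>orb (base \<sigma>). tr q ` offsets \<sigma>)"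
  then obtain \<sigma> g t where *: "\<sigma> \<in> nonempty_barriers" "g \<in> G" "t \<in> offsets \<sigma>" "p = tr (g (base \<sigma>)) t"
    by (auto simp: orb_def)
  then have "p = g (tr (base \<sigma>) t)" using base_transport by simp
  moreover have "tr (base \<sigma>) t \<in> U" using *(3) V_subset_U unfolding offsets_def by blast
  ultimately show "p \<in> U" using U_invariant[OF *(2)] by simp
qed

lemma finite_base_orb: "\<sigma> \<in> nonempty_barriers \<Longrightarrow> finite (orb (base \<sigma>))"
  using base_in_V V_subset_U unfolding U_def by blast

lemma finite_nonempty_barriers: "finite nonempty_barriers"
  using finite_barriers by (simp add: nonempty_barriers_def)

lemma finite_bd_U: "finite (bd C U)"
  unfolding U_eq
  by (intro finite_bd_UN finite_nonempty_barriers finite_base_orb finite_bd_slice offsets_bounded)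
    (auto intro: offsets_convex)

text \<open>Whole orbits are taken, not only base points: a point of \<open>U\<close> sits at an
  offset from a translate \<open>g (base \<sigma>)\<close>, and \<open>h\<close> moves it exactly as
  it moves that translate.\<close>

definition fixing_points :: "dpt set" where
  "fixing_points = (\<Union>\<sigma>\<in>nonempty_barriers. orb (base \<sigma>))"

lemma finite_fixing_points: "finite fixing_points"
  using finite_nonempty_barriers finite_base_orb by (auto simp: fixing_points_def)

lemma finite_orb_fixing_points: "x \<in> fixing_points \<Longrightarrow> finite (orb x)"
  using finite_base_orb orb_eq unfolding fixing_points_def by (metis UN_E)

lemma fixes_U:
  assumes h: "h \<in> G" "\<And>x. x \<in> fixing_points \<Longrightarrow> h x = x" and u: "u \<in> U"
  shows "h u = u"
proof -
  obtain \<sigma> g t where *: "\<sigma> \<in> nonempty_barriers" "g \<in> G" "t \<in> offsets \<sigma>" "u = tr (g (base \<sigma>)) t"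
    using u unfolding U_eq by (auto simp: orb_def)
  have "h u = (h \<circ> g) (tr (base \<sigma>) t)" using base_transport[OF *(1,3,2)] *(4) by simp
  also have "\<dots> = tr (h (g (base \<sigma>))) t"
    using base_transport[OF *(1,3) words_comp[OF h(1) *(2)]] by simp
  also have "h (g (base \<sigma>)) = g (base \<sigma>)"
    by (rule h(2)) (use *(1,2) in \<open>unfold fixing_points_def orb_def, blast\<close>)
  finally show ?thesis using *(4) by simp
qed

section \<open>Regular moves and the boundary outside the periodic set\<close>

definition R :: "(dpt \<times> dpt) set" where
  "R = {(p, s p) | p s. s \<in> A \<and> regular C s p}"

lemma regular_inverse:
  assumes "regular C s p" "s' \<circ> s = id"
  shows "regular C s' (s p)"
proof -
  have inv: "s' (s x) = x" for x using assms(2) by (metis comp_apply id_apply)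
  obtain \<delta> where "\<delta> > 0" "\<And>t. \<bar>t\<bar> < \<delta> \<Longrightarrow> s (tr p t) = tr (s p) t"
    using assms(1) unfolding regular_def by blast
  then have "\<exists>\<delta>>0. \<forall>t. \<bar>t\<bar> < \<delta> \<longrightarrow> s' (tr (s p) t) = tr (s' (s p)) t" using inv by metis
  then show ?thesis using assms(1) inv by (auto simp: regular_def)
qed

lemma sym_R: "sym R"
proof (rule symI)
  fix p q assume "(p, q) \<in> R"
  then obtain s where s: "s \<in> A" "regular C s p" "q = s p" by (auto simp: R_def)
  obtain s' where s': "s' \<in> A" "s' \<circ> s = id" using gens_inv[OF s(1)] by blast
  have p: "s' q = p" using s(3) s'(2) by (metis comp_apply id_apply)
  have "(q, s' q) \<in> R"
    using regular_inverse[OF s(2) s'(2)] s(3) s'(1) unfolding R_def by blast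
  then show "(q, p) \<in> R" unfolding p .
qed

text \<open>Dropping the infinite classes makes \<open>P\<close> finite and loses no boundary point
  of a set with finite boundary and finite orbit, since the class of such a point is finite.\<close>

definition P :: "dpt set" where
  "P = (\<Union>y\<in>{y \<in> Sing. finite (R\<^sup>* `` {y})}. R\<^sup>* `` {y})"

lemma finite_P: "finite P"
  using finite_Sing by (auto simp: P_def)

text \<open>At regular points \<open>s\<close> carries germs, so new boundary can only arise at the
  images of the finitely many irregular points.\<close>

lemma finite_bd_gen_image:
  assumes s: "s \<in> A" and fin: "finite (bd C K)"
  shows "finite (bd C (s ` K))"
proof (rule finite_subset)
  show "bd C (s ` K) \<subseteq> s ` (bd C K \<union> {p \<in> dpts C. \<not> regular C s p})"
  proof
    fix y assume y: "y \<in> bd C (s ` K)"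
    obtain s' where s': "s' \<in> A" "s \<circ> s' = id" using gens_inv[OF s] by blast
    have "y = s (s' y)" using s'(2) by (metis comp_apply id_apply)
    moreover have "s' y \<in> dpts C" using gens_dpts[OF s'(1)] y bd_subset by blast
    ultimately show "y \<in> s ` (bd C K \<union> {p \<in> dpts C. \<not> regular C s p})"
      using bd_image_iff[OF _ gens_inj[OF s], of C "s' y" K] y by auto
  qed
qed (use fin finite_irregular[OF s] in auto)

lemma finite_bd_image: "g \<in> G \<Longrightarrow> finite (bd C K) \<Longrightarrow> finite (bd C (g ` K))"
proof (induction rule: words.induct)
  case (words_step s g)
  then show ?case using finite_bd_gen_image[of s "g ` K"] by (simp add: image_comp)
qed simp

text \<open>The boundary points of all translates of \<open>J\<close> form a finite set which is closed under the
  regular moves \<open>R\<close>; so the \<open>R\<close>-class of such a point is finite, and either it meets \<open>Sing\<close>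
  or it is a full orbit.\<close>

lemma bd_subset_P_Un_U:
  assumes "finite (bd C J)" "finite (sorb J)"
  shows "bd C J \<subseteq> P \<union> U"
proof
  fix p assume p: "p \<in> bd C J"
  define F where "F = (\<Union>K\<in>sorb J. bd C K)"
  have finF: "finite F" unfolding F_def
    by (rule finite_UN_I[OF assms(2)]) (use finite_bd_image assms(1) in \<open>unfold sorb_def, blast\<close>)
  have "J \<in> sorb J" unfolding sorb_def by (rule image_eqI[of _ _ id]) (simp_all add: words_id)
  then have pF: "p \<in> F" using p by (auto simp: F_def)
  have FR: "y \<in> F" if "(x, y) \<in> R" "x \<in> F" for x y
  proof -
    obtain s where s: "s \<in> A" "regular C s x" "y = s x" using \<open>(x, y) \<in> R\<close> by (auto simp: R_def)
    obtain g where g: "g \<in> G" "x \<in> bd C (g ` J)" using \<open>x \<in> F\<close> by (auto simp: F_def sorb_def)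
    have "y \<in> bd C ((s \<circ> g) ` J)"
      using bd_image_iff[OF s(2) gens_inj[OF s(1)], of "g ` J"] g(2) s(3) by (simp add: image_comp)
    then show ?thesis using words_step[OF s(1) g(1)] unfolding F_def sorb_def by blast
  qed
  have "y \<in> F" if "(x, y) \<in> R\<^sup>*" "x \<in> F" for x y
    using that by (induction rule: rtrancl_induct) (auto intro: FR)
  then have reach: "finite (R\<^sup>* `` {x})" if "x \<in> F" for x
    using finite_subset[OF _ finF, of "R\<^sup>* `` {x}"] that by blast
  show "p \<in> P \<union> U"
  proof (cases "R\<^sup>* `` {p} \<inter> Sing = {}")
    case False
    then obtain y where y: "(p, y) \<in> R\<^sup>*" "y \<in> Sing" by blast
    have "y \<in> F" using \<open>\<And>x y. (x, y) \<in> R\<^sup>* \<Longrightarrow> x \<in> F \<Longrightarrow> y \<in> F\<close> y(1) pF by blast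
    \<comment> \<open>The classes in \<open>P\<close> start at singular points, so the path from
      \<open>p\<close> to \<open>y\<close> is reversed; the class of \<open>y\<close> is finite
      because \<open>y\<close> lies in \<open>F\<close>.\<close>
    moreover have "(y, p) \<in> R\<^sup>*" using y(1) sym_rtrancl[OF sym_R] by (meson symD)
    ultimately show ?thesis using y(2) reach unfolding P_def by blast
  next
    case True
    have pD: "p \<in> dpts C" using p bd_subset by blast
    \<comment> \<open>With no singular point in the class, each letter of a word is a regular move,
      so the class exhausts the orbit.\<close>
    have "(p, g p) \<in> R\<^sup>*" if "g \<in> G" for g
      using that
    proof (induction rule: words.induct)
      case (words_step s g)
      then have "g p \<notin> Sing" using True by blast
      then have "regular C s (g p)" using words_dpts[OF words_step(2) pD] words_step(1) by (auto simp: Sing_def)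
      then have "(g p, s (g p)) \<in> R" using words_step(1) unfolding R_def by blast
      then show ?case using words_step by (auto intro: rtrancl_into_rtrancl)
    qed simp
    then have "orb p \<subseteq> R\<^sup>* `` {p}" by (auto simp: orb_def)
    then have "p \<in> U" using True reach[OF pF] pD finite_subset by (auto simp: U_def)
    then show ?thesis by blast
  qed
qed

text \<open>Off \<open>bd C U\<close> a point has a neighbourhood on one side of \<open>U\<close>.
  Inside \<open>U\<close> the set \<open>J - U\<close> is locally empty; outside, it agrees with
  \<open>J\<close>, and of the two places for boundary points of \<open>J\<close> only
  \<open>P\<close> remains.\<close>

lemma bd_Diff_U_subset:
  assumes "finite (bd C J)" "finite (sorb J)"
  shows "bd C (J - U) \<subseteq> P \<union> bd C U"
proof
  fix p assume p: "p \<in> bd C (J - U)"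
  show "p \<in> P \<union> bd C U"
  proof (cases "p \<in> bd C U")
    case False
    have pD: "p \<in> dpts C" using p bd_subset by blast
    obtain \<delta> where \<delta>: "\<delta> > 0" "\<And>t. \<bar>t\<bar> < \<delta> \<Longrightarrow> (tr p t \<in> U) = (p \<in> U)"
      using not_bd_iff[OF pD] False by blast
    have "p \<notin> U"
    proof
      assume "p \<in> U"
      then have "\<exists>\<delta>>0. \<forall>t. \<bar>t\<bar> < \<delta> \<longrightarrow> (tr p t \<in> J - U) = (p \<in> J - U)" using \<delta> by auto
      then show False using p not_bd_iff[OF pD] by blast
    qed
    moreover have "p \<in> bd C (J - U) \<longleftrightarrow> p \<in> bd C J"
      by (rule bd_local[OF pD pD \<delta>(1)]) (use \<delta>(2) \<open>p \<notin> U\<close> in auto)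
    ultimately show ?thesis using p bd_subset_P_Un_U[OF assms] by blast
  qed blast
qed

text \<open>The two finiteness conditions stand in for invariance under a finite index subgroup:
  every subdomain with such invariance satisfies them, and they refer to the orbit alone.\<close>

definition aperiodic_parts :: "dpt set set" where
  "aperiodic_parts = {J - U | J. J \<subseteq> dpts C \<and> finite (bd C J) \<and> finite (sorb J)}"

lemma finite_aperiodic_parts: "finite aperiodic_parts"
proof (rule finite_subset[OF _ finite_sets_bd_subset])
  show "aperiodic_parts \<subseteq> {K. K \<subseteq> dpts C \<and> bd C K \<subseteq> P \<union> bd C U}"
    using bd_Diff_U_subset by (auto simp: aperiodic_parts_def)
qed (use finite_P finite_bd_U in simp)

lemma finite_sorb_aperiodic_parts: "K \<in> aperiodic_parts \<Longrightarrow> finite (sorb K)"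
proof -
  assume "K \<in> aperiodic_parts"
  then obtain J where J: "K = J - U" "finite (sorb J)" by (auto simp: aperiodic_parts_def)
  have "g ` (J - U) = g ` J - U" if "g \<in> G" for g
    using image_set_diff[OF words_inj[OF that]] U_image[OF that] by simp
  then have "sorb K \<subseteq> (\<lambda>L. L - U) ` sorb J" using J(1) by (auto simp: sorb_def)
  then show ?thesis using J(2) finite_surj by blast
qed

lemma fixes_finite_orbit_sets:
  assumes h: "h \<in> G" "\<And>x. x \<in> fixing_points \<Longrightarrow> h x = x" "\<And>K. K \<in> aperiodic_parts \<Longrightarrow> h ` K = K"
    and J: "J \<subseteq> dpts C" "finite (bd C J)" "finite (sorb J)"
  shows "h ` J = J"
proof -
  have "h ` (J - U) = J - U" using h(3) J by (auto simp: aperiodic_parts_def)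
  moreover have "h ` (J \<inter> U) = J \<inter> U" using fixes_U[OF h(1,2)] by force
  moreover have "J = (J - U) \<union> (J \<inter> U)" by blast
  ultimately show ?thesis by (metis image_Un)
qed

end

section \<open>Stability\<close>

text \<open>Away from coordinate 0, \<open>shift\<close> and \<open>tr\<close> agree for small
  parameters. This is needed at \<open>p\<close> and at its image.\<close>

lemma regularI:
  assumes f: "iet C f" and p: "p \<in> dpts C" "snd p \<noteq> 0" "snd (f p) \<noteq> 0" "loc_transl C f p"
  shows "regular C f p"
proof -
  have near: "\<exists>\<delta>>0. \<forall>t. \<bar>t\<bar> < \<delta> \<longrightarrow> tr q t \<in> dpts C \<and> shift C q t = tr q t"
    if "q \<in> dpts C" "snd q \<noteq> 0" for q
    using that shift_eq_plain[of q _ C]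
    by (intro exI[of _ "min (snd q) (snd (C ! fst q) - snd q)"]) (auto simp: mem_dpts tr_def)
  have fp: "f p \<in> dpts C" using iet_in_dpts[OF f p(1)] .
  obtain d where d: "d > 0" "\<And>t. \<bar>t\<bar> < d \<Longrightarrow> tr p t \<in> dpts C \<and> shift C p t = tr p t"
    using near p by blast
  obtain e where e: "e > 0" "\<And>t. \<bar>t\<bar> < e \<Longrightarrow> shift C (f p) t = tr (f p) t"
    using near fp p by blast
  obtain c where c: "c > 0" "\<And>t. \<bar>t\<bar> < c \<Longrightarrow> shift C p t \<in> dpts C \<Longrightarrow> f (shift C p t) = shift C (f p) t"
    using p(4) unfolding loc_transl_def by blast
  have "f (tr p t) = tr (f p) t" if "\<bar>t\<bar> < min c (min d e)" for t
    using that c(2)[of t] d(2)[of t] e(2)[of t] by simp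
  moreover have "min c (min d e) > 0" using c d e by simp
  ultimately show ?thesis using p(1) fp unfolding regular_def by blast
qed

lemma finite_irregular_iet:
  assumes f: "iet C f" shows "finite {p \<in> dpts C. \<not> regular C f p}"
proof (rule finite_subset)
  let ?O = "{p \<in> dpts C. snd p = 0}"
  show "{p \<in> dpts C. \<not> regular C f p} \<subseteq> {p \<in> dpts C. \<not> loc_transl C f p} \<union> ?O \<union> f -` ?O"
    using regularI[OF f] iet_in_dpts[OF f] by blast
  show "finite ({p \<in> dpts C. \<not> loc_transl C f p} \<union> ?O \<union> f -` ?O)"
    by (intro finite_UnI finite_vimageI iet_finite_bad[OF f] finite_origins bij_is_inj[OF iet_bij[OF f]])
qed

lemma piecewise_translations_iet:
  assumes "finite A" "\<And>f. f \<in> A \<Longrightarrow> iet C f"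
  shows "piecewise_translations C (A \<union> inv_into UNIV ` A)"
proof
  let ?B = "A \<union> inv_into UNIV ` A"
  have iet: "iet C s" if "s \<in> ?B" for s using that assms(2) iet_inv by blast
  show "finite ?B" using assms(1) by simp
  fix s assume s: "s \<in> ?B"
  show "finite {p \<in> dpts C. \<not> regular C s p}" by (rule finite_irregular_iet[OF iet[OF s]])
  show "s p \<in> dpts C" if "p \<in> dpts C" for p using iet_in_dpts iet s that by blast
  have b: "bij f" if "f \<in> A" for f using iet_bij assms(2) that by blast
  have *: "inv_into UNIV f \<circ> f = id" "f \<circ> inv_into UNIV f = id" if "f \<in> A" for f
    using b[OF that] by (simp_all add: bij_def surj_iff)
  from s show "\<exists>s'\<in>?B. s' \<circ> s = id \<and> s \<circ> s' = id"
  proof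
    assume "s \<in> A" then show ?thesis using * by blast
  next
    assume "s \<in> inv_into UNIV ` A"
    then obtain f where "f \<in> A" "s = inv_into UNIV f" by blast
    then show ?thesis using * by blast
  qed
qed

lemma generate_iet_group:
  assumes "\<And>f. f \<in> A \<Longrightarrow> iet C f"
  shows "generate (iet_group C) A = words (A \<union> inv_into UNIV ` A)"
proof (intro equalityI subsetI)
  fix g assume "g \<in> generate (iet_group C) A"
  then show "g \<in> words (A \<union> inv_into UNIV ` A)"
  proof (induction rule: generate.induct)
    case one
    then show ?case using words_id[of "A \<union> inv_into UNIV ` A"] by (simp add: iet_group_def id_def)
  next
    case (incl h)
    then show ?case by (simp add: words_gen)
  next
    case (inv h)
    then show ?case using inv_iet_group[OF assms] by (simp add: words_gen)
  next
    case (eng h1 h2)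
    then show ?case using words_comp[OF eng(3,4)] by (simp add: iet_group_def comp_def)
  qed
next
  fix g assume "g \<in> words (A \<union> inv_into UNIV ` A)"
  then show "g \<in> generate (iet_group C) A"
  proof (induction rule: words.induct)
    case words_id
    then show ?case using generate.one[of "iet_group C" A] by (simp add: iet_group_def id_def)
  next
    case (words_step s g)
    have "s \<in> generate (iet_group C) A"
      using words_step(1) generate.incl generate.inv inv_iet_group[OF assms] by (metis UnE imageE)
    then show ?case using generate.eng[OF _ words_step(3)] by (simp add: iet_group_def comp_def)
  qed
qed

text \<open>In the cut-open coordinate an arc that wraps around a circle becomes two segments. The
  second one is empty when nothing wraps, in particular on an interval component.\<close>

lemma arc_eq:
  assumes "valid_arc C i a l"
  shows "arc C i a l = tr (i, 0) ` {a..<min (a + l) (snd (C ! i))} \<union> tr (i, 0) ` {0..<a + l - snd (C ! i)}"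
proof -
  let ?L = "snd (C ! i)"
  have v: "i < length C" "0 \<le> a" "a < ?L" "l > 0" "fst (C ! i) \<Longrightarrow> l \<le> ?L" "\<not> fst (C ! i) \<Longrightarrow> a + l \<le> ?L"
    using assms by (auto simp: valid_arc_def split: if_splits)
  have low: "shift C (i, a) t = tr (i, 0) (a + t)" if "0 \<le> t" "a + t < ?L" for t
    using shift_eq_plain[of "(i, a)" t C] that v by (simp add: tr_def)
  have high: "shift C (i, a) t = tr (i, 0) (a + t - ?L)" if "t < l" "?L \<le> a + t" for t
  proof -
    have c: "fst (C ! i)" using that v(6) by fastforce
    have L: "?L > 0" using v by linarith
    \<comment> \<open>One turn is subtracted: \<open>a + t\<close> stays below \<open>2 * ?L\<close>
      because \<open>a < ?L\<close> and \<open>t < l \<le> ?L\<close>.\<close>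
    have "frac ((a + t) / ?L) = (a + t - ?L) / ?L"
      unfolding frac_unique_iff using that v(3) v(5)[OF c] L by (simp add: field_simps)
    then show ?thesis using c L by (simp add: shift_def tr_def)
  qed
  show ?thesis
  proof (intro equalityI subsetI)
    fix p assume "p \<in> arc C i a l"
    then obtain t where t: "0 \<le> t" "t < l" "p = shift C (i, a) t" by (auto simp: arc_def)
    show "p \<in> tr (i, 0) ` {a..<min (a + l) ?L} \<union> tr (i, 0) ` {0..<a + l - ?L}"
    proof (cases "a + t < ?L")
      case True
      then show ?thesis using t low[OF t(1)] by auto
    next
      case False
      then show ?thesis using t high[OF t(2)] by auto
    qed
  next
    fix p assume "p \<in> tr (i, 0) ` {a..<min (a + l) ?L} \<union> tr (i, 0) ` {0..<a + l - ?L}"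
    then show "p \<in> arc C i a l"
    proof (elim UnE imageE)
      fix x assume "p = tr (i, 0) x" "x \<in> {a..<min (a + l) ?L}"
      then have "p = shift C (i, a) (x - a)" "0 \<le> x - a" "x - a < l" using low[of "x - a"] by auto
      then show ?thesis unfolding arc_def by blast
    next
      fix x assume "p = tr (i, 0) x" "x \<in> {0..<a + l - ?L}"
      then have "p = shift C (i, a) (x + ?L - a)" "0 \<le> x + ?L - a" "x + ?L - a < l"
        using high[of "x + ?L - a"] v by auto
      then show ?thesis unfolding arc_def by blast
    qed
  qed
qed

lemma arc_subset_dpts:
  assumes "valid_arc C i a l" shows "arc C i a l \<subseteq> dpts C"
  using assms unfolding arc_eq[OF assms] by (auto simp: valid_arc_def mem_dpts split: if_splits)

lemma finite_bd_arc:
  assumes "valid_arc C i a l" shows "finite (bd C (arc C i a l))"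
  unfolding arc_eq[OF assms]
  by (rule finite_subset[OF bd_Un]) (intro finite_UnI finite_bd_slice, auto)

lemma subdomain_subset_dpts: "subdomain C J \<Longrightarrow> J \<subseteq> dpts C"
  unfolding subdomain_def using arc_subset_dpts by (force simp: split_beta)

lemma finite_bd_subdomain: "subdomain C J \<Longrightarrow> finite (bd C J)"
proof -
  assume "subdomain C J"
  then obtain A where A: "finite A" "\<forall>(i, a, l)\<in>A. valid_arc C i a l"
    "J = (\<Union>x\<in>A. arc C (fst x) (fst (snd x)) (snd (snd x)))"
    by (auto simp: subdomain_def split_beta)
  show ?thesis unfolding A(3)
    by (intro finite_bd_UN finite_bd_arc A(1)) (use A(2) in auto)
qed

text \<open>Finiteness of the orbit under \<open>H\<close> is assumed instead of invariance, so that
  the statement can be iterated along a chain of subgroups.\<close>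

lemma finite_orbit_from_finite_index:
  assumes K: "subgroup K (iet_group C)" and H: "finite_index_in C H K"
    and fin: "finite ((\<lambda>h. h ` J) ` H)"
  shows "finite ((\<lambda>g. g ` J) ` K)"
proof -
  let ?G = "iet_group C"
  interpret group ?G by (rule group_iet_group)
  have H': "subgroup H ?G" "H \<subseteq> K" "finite (rcosets\<^bsub>?G\<lparr>carrier := K\<rparr>\<^esub> H)"
    using H by (auto simp: finite_index_in_def)
  have KG: "K \<subseteq> carrier ?G" by (rule subgroup.subset[OF K])
  obtain T where T: "finite T" "T \<subseteq> K" "\<And>g. g \<in> K \<Longrightarrow> \<exists>t\<in>T. g \<otimes>\<^bsub>?G\<^esub> inv\<^bsub>?G\<^esub> t \<in> H"
    using finite_index_transversal[OF K H'] by metis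
  have "(\<lambda>g. g ` J) ` K \<subseteq> (\<lambda>(t, L). (inv\<^bsub>?G\<^esub> t) ` L) ` (T \<times> (\<lambda>h. h ` J) ` H)"
  proof
    fix L assume "L \<in> (\<lambda>g. g ` J) ` K"
    then obtain g where g: "g \<in> K" "L = g ` J" by blast
    \<comment> \<open>The transversal is for right cosets, so it is applied to the inverse of
      \<open>g\<close>; inverting again puts \<open>t\<close> times \<open>g\<close> into
      \<open>H\<close>, and \<open>g\<close> is recovered by the inverse of
      \<open>t\<close>.\<close>
    obtain t where t: "t \<in> T" "inv\<^bsub>?G\<^esub> g \<otimes>\<^bsub>?G\<^esub> inv\<^bsub>?G\<^esub> t \<in> H"
      using T(3) subgroup.m_inv_closed[OF K g(1)] by blast
    have c: "g \<in> carrier ?G" "t \<in> carrier ?G" using g t T(2) KG by auto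
    have "inv\<^bsub>?G\<^esub> (inv\<^bsub>?G\<^esub> g \<otimes>\<^bsub>?G\<^esub> inv\<^bsub>?G\<^esub> t) = t \<otimes>\<^bsub>?G\<^esub> g"
      using c by (simp add: inv_mult_group)
    then have h: "t \<otimes>\<^bsub>?G\<^esub> g \<in> H" using subgroup.m_inv_closed[OF H'(1) t(2)] by simp
    have "g = inv\<^bsub>?G\<^esub> t \<otimes>\<^bsub>?G\<^esub> (t \<otimes>\<^bsub>?G\<^esub> g)" using c by (simp add: m_assoc[symmetric])
    then have "g = inv\<^bsub>?G\<^esub> t \<circ> (t \<otimes>\<^bsub>?G\<^esub> g)" by (simp add: iet_group_def)
    then have "L = (inv\<^bsub>?G\<^esub> t) ` (t \<otimes>\<^bsub>?G\<^esub> g) ` J" using g(2) by (metis image_comp)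
    then show "L \<in> (\<lambda>(t, L). (inv\<^bsub>?G\<^esub> t) ` L) ` (T \<times> (\<lambda>h. h ` J) ` H)"
      using t(1) h by blast
  qed
  then show ?thesis by (rule finite_subset) (use T(1) fin in simp)
qed

lemma finite_index_common_stabilizer:
  assumes G: "subgroup G (iet_group C)" and fin: "finite Y" "finite \<K>"
    and orbits: "\<And>x. x \<in> Y \<Longrightarrow> finite ((\<lambda>g. g x) ` G)" "\<And>K. K \<in> \<K> \<Longrightarrow> finite ((\<lambda>g. g ` K) ` G)"
  shows "finite_index_in C {g \<in> G. (\<forall>x\<in>Y. g x = x) \<and> (\<forall>K\<in>\<K>. g ` K = K)} G"
proof -
  let ?G = "iet_group C"
  define H where "H = {g \<in> G. (\<forall>x\<in>Y. g x = x) \<and> (\<forall>K\<in>\<K>. g ` K = K)}"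
  interpret group ?G by (rule group_iet_group)
  have iet: "iet C g" if "g \<in> G" for g using that subgroup.subset[OF G] by (auto simp: iet_group_def)
  have invG: "inv_into UNIV g \<in> G" if "g \<in> G" for g
    using subgroup.m_inv_closed[OF G that] inv_iet_group[OF iet[OF that]] by simp
  have inv_l: "inv_into UNIV g (g x) = x" and inv_r: "g (inv_into UNIV g x) = x" if "g \<in> G" for g x
    using iet_bij[OF iet[OF that]] by (simp_all add: bij_is_inj bij_is_surj surj_f_inv_f)
  have inv_im: "g ` inv_into UNIV g ` K = K" "inv_into UNIV g ` g ` K = K" if "g \<in> G" for g K
    using inv_l[OF that] inv_r[OF that] by (simp_all add: image_image)
  have sub: "subgroup H ?G"
  proof (rule subgroupI)
    show "H \<subseteq> carrier ?G" using subgroup.subset[OF G] by (auto simp: H_def)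
    have "id \<in> H" using subgroup.one_closed[OF G] by (simp add: H_def iet_group_def)
    then show "H \<noteq> {}" by blast
    show "inv\<^bsub>?G\<^esub> g \<in> H" if g: "g \<in> H" for g
    proof -
      have g': "g \<in> G" "\<And>x. x \<in> Y \<Longrightarrow> g x = x" "\<And>K. K \<in> \<K> \<Longrightarrow> g ` K = K"
        using g by (auto simp: H_def)
      have "inv_into UNIV g x = x" if "x \<in> Y" for x using inv_l[OF g'(1), of x] g'(2)[OF that] by simp
      moreover have "inv_into UNIV g ` K = K" if "K \<in> \<K>" for K
        using inv_im(2)[OF g'(1), of K] g'(3)[OF that] by simp
      ultimately show ?thesis using invG[OF g'(1)] inv_iet_group[OF iet[OF g'(1)]] by (simp add: H_def)
    qed
    show "f \<otimes>\<^bsub>?G\<^esub> g \<in> H" if "f \<in> H" "g \<in> H" for f g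
    proof -
      have "f \<otimes>\<^bsub>?G\<^esub> g = f \<circ> g" by (simp add: iet_group_def)
      moreover have "(f \<circ> g) ` K = K" if "K \<in> \<K>" for K
        using \<open>f \<in> H\<close> \<open>g \<in> H\<close> that by (simp add: H_def image_comp[symmetric] del: image_comp o_apply)
      ultimately show ?thesis using that subgroup.m_closed[OF G, of f g] by (simp add: H_def)
    qed
  qed
  \<comment> \<open>Inverses are recorded because of the right coset convention: if the inverses of
    \<open>a\<close> and \<open>b\<close> act alike, then \<open>b\<close> composed with the inverse
    of \<open>a\<close> fixes everything in \<open>Y\<close> and \<open>\<K>\<close>.\<close>
  define \<phi> where "\<phi> g = (restrict (inv_into UNIV g) Y, restrict (\<lambda>K. inv_into UNIV g ` K) \<K>)" for g :: "dpt \<Rightarrow> dpt"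
  have "finite (rcosets\<^bsub>?G\<lparr>carrier := G\<rparr>\<^esub> H)"
  proof (rule finite_rcosetsI[OF G sub, of \<phi>])
    have "\<phi> ` G \<subseteq> (\<Pi>\<^sub>E x\<in>Y. (\<lambda>g. g x) ` G) \<times> (\<Pi>\<^sub>E K\<in>\<K>. (\<lambda>g. g ` K) ` G)"
      using invG by (auto simp: \<phi>_def PiE_def extensional_def)
    then show "finite (\<phi> ` G)"
      by (rule finite_subset) (intro finite_cartesian_product finite_PiE fin orbits)
    fix a b assume ab: "a \<in> G" "b \<in> G" "\<phi> a = \<phi> b"
    have "inv_into UNIV a x = inv_into UNIV b x" if "x \<in> Y" for x
      using ab(3) that unfolding \<phi>_def by (metis fst_conv restrict_apply')
    moreover have "inv_into UNIV a ` K = inv_into UNIV b ` K" if "K \<in> \<K>" for K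
      using ab(3) that unfolding \<phi>_def by (metis (mono_tags, lifting) snd_conv restrict_apply')
    moreover have "b \<otimes>\<^bsub>?G\<^esub> inv\<^bsub>?G\<^esub> a = b \<circ> inv_into UNIV a"
      using inv_iet_group[OF iet[OF ab(1)]] by (simp add: iet_group_def)
    moreover have "b \<otimes>\<^bsub>?G\<^esub> inv\<^bsub>?G\<^esub> a \<in> G"
      using ab subgroup.m_closed[OF G] subgroup.m_inv_closed[OF G] by blast
    moreover have "(b \<circ> inv_into UNIV a) ` K = b ` inv_into UNIV a ` K" for K
      by (simp only: image_comp)
    ultimately show "b \<otimes>\<^bsub>?G\<^esub> inv\<^bsub>?G\<^esub> a \<in> H"
      using inv_r[OF ab(2)] inv_im(1)[OF ab(2)] by (simp add: H_def del: image_comp)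
  qed
  then show ?thesis using sub unfolding finite_index_in_def H_def by auto
qed

theorem mainTheorem7:
  assumes "is_domain C" and "fg_subgroup C G"
  shows "\<exists>H. finite_index_in C H G \<and> stable C H"
proof -
  let ?I = "iet_group C"
  interpret I: group ?I by (rule group_iet_group)
  obtain A where A: "finite A" "A \<subseteq> carrier ?I" "G = generate ?I A" and G: "subgroup G ?I"
    using assms(2) by (auto simp: fg_subgroup_def)
  have iet: "\<And>f. f \<in> A \<Longrightarrow> iet C f" using A(2) by (auto simp: iet_group_def)
  interpret D: piecewise_translations C "A \<union> inv_into UNIV ` A"
    by (rule piecewise_translations_iet[OF A(1) iet])
  have GD: "words (A \<union> inv_into UNIV ` A) = G" using generate_iet_group[OF iet] A(3) by simp
  \<comment> \<open>Only data of the generators enter, so one \<open>H\<close> serves every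
    \<open>J\<close>.\<close>
  define H where "H = {g \<in> G. (\<forall>x\<in>D.fixing_points. g x = x) \<and> (\<forall>K\<in>D.aperiodic_parts. g ` K = K)}"
  have fi: "finite_index_in C H G"
    unfolding H_def
    using D.finite_orb_fixing_points D.finite_sorb_aperiodic_parts
    by (intro finite_index_common_stabilizer G D.finite_fixing_points D.finite_aperiodic_parts)
      (auto simp: D.orb_def D.sorb_def GD)
  then have H: "subgroup H ?I" "H \<subseteq> G" "finite (rcosets\<^bsub>?I\<lparr>carrier := G\<rparr>\<^esub> H)"
    by (auto simp: finite_index_in_def)
  \<comment> \<open>\<open>stable\<close> includes finite generation, which the stabilizer inherits
    through its finite index in \<open>G\<close>.\<close>
  obtain B where B: "finite B" "B \<subseteq> H" "H = generate ?I B"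
    using I.finite_index_subgroup_finitely_generated[OF A(1,2) H(1)] H A(3) by blast
  have fg: "fg_subgroup C H"
    using B H(1) subgroup.subset[OF H(1)] unfolding fg_subgroup_def by blast
  have "invariant_under H J" if J: "subdomain C J" and H': "finite_index_in C H' H" "invariant_under H' J" for J H'
  proof -
    have "(\<lambda>h. h ` J) ` H' \<subseteq> {J}" using H'(2) by (auto simp: invariant_under_def)
    then have "finite ((\<lambda>h. h ` J) ` H')" by (rule finite_subset) simp
    \<comment> \<open>The orbit is bounded in two stages, from \<open>H'\<close> to \<open>H\<close>
      and from \<open>H\<close> to \<open>G\<close>.\<close>
    then have "finite ((\<lambda>g. g ` J) ` G)"
      by (intro finite_orbit_from_finite_index[OF G fi] finite_orbit_from_finite_index[OF H(1) H'(1)])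
    then have sorb: "finite (D.sorb J)" by (simp add: D.sorb_def GD)
    have "h ` J = J" if "h \<in> H" for h
      by (rule D.fixes_finite_orbit_sets[OF _ _ _ subdomain_subset_dpts[OF J] finite_bd_subdomain[OF J]])
        (use that sorb in \<open>auto simp: H_def GD\<close>)
    then show ?thesis by (simp add: invariant_under_def)
  qed
  then have "stable C H" using fg unfolding stable_def by blast
  then show ?thesis using fi by blast
qed

end
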